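(* Let $A$ be a finite étale $\mathbb Z_p$-algebra with $p\ge5$, $\eta\in A^\times$, $P$ the order of $\bar\eta$ in $(A/pA)^\times$, $\eta^P=1+pU$, $\omega=\bar U$. Let $E_\omega=\mathbb F_p[\omega]\subset A/pA$, $r=\dim_{\mathbb F_p}E_\omega$, and assume $p>r$. Fix $y_a=\gamma\eta^a$ ($\gamma\in A$), $x_a=\bar y_a$, and suppose $x_a\notin E_\omega^\perp=\{x\in A/pA:\operatorname{Tr}_{A/pA/\mathbb F_p}(xe)=0\text{ for all }e\in E_\omega\}$. Then $F_a(t)=\operatorname{Tr}_A(y_a(\eta^P)^t)$ has a Weierstrass factor of degree at most $r-1$; in particular $F_a$ has at most $r-1$ zeros in $\mathbb Z_p$, counted with Weierstrass multiplicity.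
   Context: $(\eta^P)^t$ for $t\in\mathbb Z_p$ is the convergent binomial series, so $F_a\in\mathbb Q_p\langle t\rangle$ (indeed $\mathbb Z_p\langle t\rangle$) is a restricted power series; "Weierstrass factor" means the distinguished polynomial in the Weierstrass preparation $F_a=p^sWV$ with $V$ a unit. *)

theory Defs
  imports
    "Berlekamp_Zassenhaus.Finite_Field"
    "HOL-Computational_Algebra.Polynomial_FPS"
begin

section \<open>The ring of p-adic integers\<close>

text \<open>
  The prime p is the cardinality of the index type \<open>'p\<close>, as for the field \<open>'p mod_ring\<close> with p
  elements.  The p-adic integers are the inverse limit of the rings Z/p^n Z, the n-th component
  being stored as its representative in {0..<p^n}: the compatibility condition below also forces
  every component into this range.
\<close>

typedef (overloaded) ('p::prime_card) padic_int =
  "{x :: nat \<Rightarrow> int. \<forall>n. x (Suc n) mod int CARD('p) ^ n = x n}"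
  by (rule exI[of _ "\<lambda>_. 0"]) simp

setup_lifting type_definition_padic_int

lemma compatible_mod:
  assumes "\<forall>n. x (Suc n) mod (q::int) ^ n = x n"
  shows "x n mod q ^ n = x n" "x (Suc n) mod q ^ n = x n mod q ^ n"
proof -
  have "x (Suc n) mod q ^ n mod q ^ n = x (Suc n) mod q ^ n" by (rule mod_mod_trivial)
  then show "x n mod q ^ n = x n" unfolding assms[rule_format] .
  then show "x (Suc n) mod q ^ n = x n mod q ^ n" unfolding assms[rule_format] by simp
qed

lemma mod_pow_Suc_mod: "(a::int) mod q ^ Suc n mod q ^ n = a mod q ^ n"
  by (rule mod_mod_cancel) (simp add: le_imp_power_dvd)

instantiation padic_int :: (prime_card) comm_ring_1
begin

lift_definition zero_padic_int :: "'a padic_int" is "\<lambda>_. 0" by simp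

lift_definition one_padic_int :: "'a padic_int" is "\<lambda>n. 1 mod int CARD('a) ^ n"
  by (simp only: mod_pow_Suc_mod)

lift_definition plus_padic_int :: "'a padic_int \<Rightarrow> 'a padic_int \<Rightarrow> 'a padic_int"
  is "\<lambda>x y n. (x n + y n) mod int CARD('a) ^ n"
  by (simp only: mod_pow_Suc_mod) (intro allI mod_add_cong compatible_mod(2))

lift_definition minus_padic_int :: "'a padic_int \<Rightarrow> 'a padic_int \<Rightarrow> 'a padic_int"
  is "\<lambda>x y n. (x n - y n) mod int CARD('a) ^ n"
  by (simp only: mod_pow_Suc_mod) (intro allI mod_diff_cong compatible_mod(2))

lift_definition uminus_padic_int :: "'a padic_int \<Rightarrow> 'a padic_int"
  is "\<lambda>x n. (- x n) mod int CARD('a) ^ n"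
  by (simp only: mod_pow_Suc_mod) (intro allI mod_minus_cong compatible_mod(2))

lift_definition times_padic_int :: "'a padic_int \<Rightarrow> 'a padic_int \<Rightarrow> 'a padic_int"
  is "\<lambda>x y n. (x n * y n) mod int CARD('a) ^ n"
  by (simp only: mod_pow_Suc_mod) (intro allI mod_mult_cong compatible_mod(2))

instance
proof
  fix a b c :: "'a padic_int"
  show "a * b * c = a * (b * c)" by transfer (simp add: mod_simps algebra_simps)
  show "a * b = b * a" by transfer (simp add: mod_simps algebra_simps)
  show "1 * a = a"
    by transfer (auto simp: mod_simps fun_eq_iff intro: compatible_mod(1))
  show "a + b + c = a + (b + c)" by transfer (simp add: mod_simps algebra_simps)
  show "a + b = b + a" by transfer (simp add: mod_simps algebra_simps)
  show "0 + a = a"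
    by transfer (auto simp: mod_simps fun_eq_iff intro: compatible_mod(1))
  show "- a + a = 0" by transfer (simp add: mod_simps algebra_simps)
  show "a - b = a + - b" by transfer (simp add: mod_simps algebra_simps)
  show "(a + b) * c = a * c + b * c" by transfer (simp add: mod_simps algebra_simps)
  have "(\<lambda>n. 0) \<noteq> (\<lambda>n. 1 mod int CARD('a) ^ n)"
  proof
    assume "(\<lambda>n. 0) = (\<lambda>n. 1 mod int CARD('a) ^ n)"
    from fun_cong[OF this, of 1] have "0 = 1 mod int CARD('a) ^ 1" .
    with nontriv[where ?'a = 'a] show False by simp
  qed
  then show "(0::'a padic_int) \<noteq> 1" by transfer
qed

end

lemma Rep_padic_int_Suc_mod:
  "Rep_padic_int (x :: 'p::prime_card padic_int) (Suc n) mod int CARD('p) ^ n = Rep_padic_int x n"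
  using Rep_padic_int[of x] by simp

lemma Rep_padic_int_add_mod:
  "Rep_padic_int (x :: 'p::prime_card padic_int) (n + k) mod int CARD('p) ^ n = Rep_padic_int x n"
proof (induction k)
  case 0
  have "\<forall>n. Rep_padic_int x (Suc n) mod int CARD('p) ^ n = Rep_padic_int x n"
    using Rep_padic_int_Suc_mod by blast
  from compatible_mod(1)[OF this] show ?case by simp
next
  case (Suc k)
  have "Rep_padic_int x (n + Suc k) mod int CARD('p) ^ n
      = Rep_padic_int x (Suc (n + k)) mod int CARD('p) ^ (n + k) mod int CARD('p) ^ n"
    by (simp add: mod_mod_cancel le_imp_power_dvd)
  then show ?case using Suc Rep_padic_int_Suc_mod[of x "n + k"] by simp
qed

lemma Rep_padic_int_of_nat:
  "Rep_padic_int (of_nat m :: 'p::prime_card padic_int) n = int m mod int CARD('p) ^ n"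
proof (induction m)
  case (Suc m)
  then show ?case
    by (simp add: plus_padic_int.rep_eq one_padic_int.rep_eq mod_simps)
qed (simp add: zero_padic_int.rep_eq)

lemma prime_power_dvd_mult_split:
  fixes a b q :: int
  assumes "prime q" "q ^ (n + m) dvd a * b"
  shows "q ^ n dvd a \<or> q ^ m dvd b"
proof (rule ccontr)
  assume *: "\<not> ?thesis"
  then have "a \<noteq> 0" "b \<noteq> 0" by auto
  have "q ^ (n + m) dvd a * b \<longleftrightarrow> n + m \<le> multiplicity q (a * b)"
    using assms(1) \<open>a \<noteq> 0\<close> \<open>b \<noteq> 0\<close>
    by (intro power_dvd_iff_le_multiplicity) (auto simp: not_prime_unit)
  moreover have "multiplicity q (a * b) = multiplicity q a + multiplicity q b"
    using assms(1) \<open>a \<noteq> 0\<close> \<open>b \<noteq> 0\<close>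
    by (intro prime_elem_multiplicity_mult_distrib) auto
  ultimately have "n \<le> multiplicity q a \<or> m \<le> multiplicity q b"
    using assms(2) by linarith
  with * show False by (auto dest: multiplicity_dvd')
qed

instance padic_int :: (prime_card) idom
proof
  fix x y :: "'a padic_int"
  let ?q = "int CARD('a)"
  assume "x \<noteq> 0" "y \<noteq> 0"
  then obtain n m where n: "Rep_padic_int x n \<noteq> 0" and m: "Rep_padic_int y m \<noteq> 0"
    by (auto simp: Rep_padic_int_inject[symmetric] zero_padic_int.rep_eq fun_eq_iff)
  have "\<not> ?q ^ n dvd Rep_padic_int x (n + m)"
    using n Rep_padic_int_add_mod[of x n m] by (simp add: dvd_eq_mod_eq_0)
  moreover have "\<not> ?q ^ m dvd Rep_padic_int y (n + m)"
    using m Rep_padic_int_add_mod[of y m n] by (simp add: dvd_eq_mod_eq_0 add.commute)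
  moreover have "prime ?q" using prime_card[where ?'a = 'a] by simp
  ultimately have "\<not> ?q ^ (n + m) dvd Rep_padic_int x (n + m) * Rep_padic_int y (n + m)"
    using prime_power_dvd_mult_split by blast
  then have "Rep_padic_int (x * y) (n + m) \<noteq> 0"
    by (simp add: times_padic_int.rep_eq dvd_eq_mod_eq_0)
  then show "x * y \<noteq> 0" by (auto simp: zero_padic_int.rep_eq)
qed

instance padic_int :: (prime_card) ring_char_0
proof
  show "inj (of_nat :: nat \<Rightarrow> 'a padic_int)"
  proof (rule injI)
    fix m n :: nat
    assume eq: "(of_nat m :: 'a padic_int) = of_nat n"
    let ?k = "m + n"
    have "m + n < CARD('a) ^ ?k"
      by (rule power_gt_expt) (use nontriv[where ?'a = 'a] in simp)
    then have "m mod CARD('a) ^ ?k = m" "n mod CARD('a) ^ ?k = n"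
      by (intro mod_less; linarith)+
    moreover have "int (m mod CARD('a) ^ ?k) = int (n mod CARD('a) ^ ?k)"
      unfolding zmod_int of_nat_power Rep_padic_int_of_nat[symmetric] eq ..
    ultimately show "m = n" by linarith
  qed
qed

text \<open>
  Exact division where it is possible; the value is unspecified otherwise.
\<close>

instantiation padic_int :: (prime_card) idom_divide
begin

definition divide_padic_int :: "'a padic_int \<Rightarrow> 'a padic_int \<Rightarrow> 'a padic_int" where
  "divide_padic_int a b = (if b = 0 then 0 else (SOME c. a = c * b))"

instance
proof
  fix a b :: "'a padic_int"
  assume "b \<noteq> 0"
  then have "(SOME c. a * b = c * b) = a" by (intro some_equality) auto
  with \<open>b \<noteq> 0\<close> show "a * b div b = a" by (simp add: divide_padic_int_def)
qed (simp add: divide_padic_int_def)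

end


section \<open>Finite free algebras, trace, finite etale algebras\<close>

definition is_algebra :: "('k::comm_ring_1 \<Rightarrow> 'b::comm_ring \<Rightarrow> 'b) \<Rightarrow> bool" where
  "is_algebra scale \<longleftrightarrow> Modules.module scale \<and> (\<forall>c x y. scale c (x * y) = scale c x * y)"

definition is_basis :: "('k::comm_ring_1 \<Rightarrow> 'b::ab_group_add \<Rightarrow> 'b) \<Rightarrow> 'b set \<Rightarrow> bool" where
  "is_basis scale B \<longleftrightarrow> finite B \<and> \<not> Modules.module.dependent scale B \<and> Modules.module.span scale B = UNIV"

text \<open>The trace of multiplication by \<open>x\<close>; it does not depend on the basis that is chosen.\<close>

definition alg_trace :: "('k::comm_ring_1 \<Rightarrow> 'b::comm_ring \<Rightarrow> 'b) \<Rightarrow> 'b \<Rightarrow> 'k" where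
  "alg_trace scale x = (let B = SOME B. is_basis scale B in
     \<Sum>b\<in>B. Modules.module.representation scale B (x * b) b)"

text \<open>
  Finite etale algebras in the sense of Lenstra (Galois theory for schemes): locally on the base
  free of finite rank, with x \<open>\<mapsto>\<close> (y \<open>\<mapsto>\<close> Tr (x y)) an isomorphism from the algebra onto its dual
  module.  Here the base is a local ring, so that locally free means free.
\<close>

definition finite_etale :: "('p::prime_card padic_int \<Rightarrow> 'a::comm_ring_1 \<Rightarrow> 'a) \<Rightarrow> bool" where
  "finite_etale scale \<longleftrightarrow> is_algebra scale \<and> (\<exists>B. is_basis scale B) \<and>
     (\<forall>\<phi>. Modules.module_hom scale (*) \<phi> \<longrightarrow> (\<exists>!x. \<forall>y. \<phi> y = alg_trace scale (x * y)))"


section \<open>Reduction modulo p\<close>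

definition cong_p :: "'p::prime_card itself \<Rightarrow> 'a::comm_ring_1 \<Rightarrow> 'a \<Rightarrow> bool" where
  "cong_p _ x y \<longleftrightarrow> of_nat CARD('p) dvd x - y"

text \<open>
  The type \<open>('a, 'p) modp\<close> is the quotient ring A/pA.  It may be the zero ring, so it is not an
  instance of \<open>comm_ring_1\<close>, which requires 0 and 1 to be distinct.
\<close>

quotient_type (overloaded) ('a, 'p) modp = "'a::comm_ring_1" / "cong_p TYPE('p::prime_card)"
  morphisms rep_modp modp
proof (rule equivpI)
  show "reflp (cong_p TYPE('p) :: 'a \<Rightarrow> _)" by (simp add: reflp_def cong_p_def)
  show "symp (cong_p TYPE('p) :: 'a \<Rightarrow> _)"
  proof (rule sympI)
    fix x y :: 'a
    assume "cong_p TYPE('p) x y"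
    then have "of_nat CARD('p) dvd - (x - y)" unfolding cong_p_def dvd_minus_iff .
    then show "cong_p TYPE('p) y x" unfolding cong_p_def minus_diff_eq .
  qed
  show "transp (cong_p TYPE('p) :: 'a \<Rightarrow> _)"
  proof (rule transpI)
    fix x y z :: 'a
    assume "cong_p TYPE('p) x y" "cong_p TYPE('p) y z"
    then have "of_nat CARD('p) dvd (x - y) + (y - z)" unfolding cong_p_def by (rule dvd_add)
    then show "cong_p TYPE('p) x z" by (simp add: cong_p_def)
  qed
qed

instantiation modp :: (comm_ring_1, prime_card) "{comm_ring, comm_monoid_mult}"
begin

lift_definition zero_modp :: "('a, 'b) modp" is 0 .
lift_definition one_modp :: "('a, 'b) modp" is 1 .

lift_definition plus_modp :: "('a, 'b) modp \<Rightarrow> ('a, 'b) modp \<Rightarrow> ('a, 'b) modp" is "(+)"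
  unfolding cong_p_def by (drule (1) dvd_add) (simp add: algebra_simps)

lift_definition minus_modp :: "('a, 'b) modp \<Rightarrow> ('a, 'b) modp \<Rightarrow> ('a, 'b) modp" is "(-)"
  unfolding cong_p_def by (drule (1) dvd_diff) (simp add: algebra_simps)

lift_definition uminus_modp :: "('a, 'b) modp \<Rightarrow> ('a, 'b) modp" is "uminus"
  unfolding cong_p_def by (metis minus_diff_minus dvd_minus_iff)

lift_definition times_modp :: "('a, 'b) modp \<Rightarrow> ('a, 'b) modp \<Rightarrow> ('a, 'b) modp" is "(*)"
  unfolding cong_p_def by (metis mult_diff_mult dvd_add dvd_mult dvd_mult2)

instance
  by standard (transfer; simp add: cong_p_def algebra_simps)+

end

text \<open>
  A/pA as an algebra over the field with p elements: c acts as any integer representing it.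
\<close>

lift_definition modp_scale :: "'p::prime_card mod_ring \<Rightarrow> ('a::comm_ring_1, 'p) modp \<Rightarrow> ('a, 'p) modp"
  is "\<lambda>c x. of_int (to_int_mod_ring c) * x"
  unfolding cong_p_def by (metis right_diff_distrib dvd_mult)

text \<open>As for \<open>ord\<close> in the algebra library, elements of infinite order have order 0.\<close>

definition elt_order :: "'b::monoid_mult \<Rightarrow> nat" where
  "elt_order x = (if \<exists>k>0. x ^ k = 1 then LEAST k. k > 0 \<and> x ^ k = 1 else 0)"

definition adjoin :: "('k::comm_ring_1 \<Rightarrow> 'b::{comm_ring, comm_monoid_mult} \<Rightarrow> 'b) \<Rightarrow> 'b \<Rightarrow> 'b set" where
  "adjoin scale w = range (\<lambda>f :: 'k poly. \<Sum>i\<le>degree f. scale (coeff f i) (w ^ i))"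

definition trace_perp :: "('k::comm_ring_1 \<Rightarrow> 'b::comm_ring \<Rightarrow> 'b) \<Rightarrow> 'b set \<Rightarrow> 'b set" where
  "trace_perp scale E = {x. \<forall>e\<in>E. alg_trace scale (x * e) = 0}"


section \<open>p-adic convergence and binomial powers\<close>

definition adic_tendsto :: "'b::comm_ring_1 \<Rightarrow> (nat \<Rightarrow> 'b) \<Rightarrow> 'b \<Rightarrow> bool" where
  "adic_tendsto q X L \<longleftrightarrow> (\<forall>n. eventually (\<lambda>N. q ^ n dvd X N - L) sequentially)"

definition adic_sums :: "'b::comm_ring_1 \<Rightarrow> (nat \<Rightarrow> 'b) \<Rightarrow> 'b \<Rightarrow> bool" where
  "adic_sums q f L \<longleftrightarrow> adic_tendsto q (\<lambda>N. \<Sum>k<N. f k) L"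

text \<open>
  The formula of \<open>gchoose\<close>, whose type constraint asks for a field.  The division is exact, as
  binomial coefficients of p-adic integers are p-adic integers.
\<close>

definition padic_binomial :: "'p::prime_card padic_int \<Rightarrow> nat \<Rightarrow> 'p padic_int" where
  "padic_binomial t k = (\<Prod>i<k. t - of_nat i) div fact k"

text \<open>
  u^t as the sum of the binomial series of (1 + (u - 1))^t, meant for u congruent to 1 modulo p.
\<close>

definition binomial_power :: "('p::prime_card padic_int \<Rightarrow> 'a::comm_ring_1 \<Rightarrow> 'a) \<Rightarrow> 'a \<Rightarrow> 'p padic_int \<Rightarrow> 'a" where
  "binomial_power scale u t =
     (THE L. adic_sums (of_nat CARD('p)) (\<lambda>k. scale (padic_binomial t k) ((u - 1) ^ k)) L)"


section \<open>Restricted power series and Weierstrass preparation\<close>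

definition restricted :: "'p::prime_card padic_int fps \<Rightarrow> bool" where
  "restricted F \<longleftrightarrow> adic_tendsto (of_nat CARD('p)) (fps_nth F) 0"

definition restricted_unit :: "'p::prime_card padic_int fps \<Rightarrow> bool" where
  "restricted_unit V \<longleftrightarrow> restricted V \<and> (\<exists>V'. restricted V' \<and> V * V' = 1)"

definition restricted_expansion ::
  "'p::prime_card padic_int fps \<Rightarrow> ('p padic_int \<Rightarrow> 'p padic_int) \<Rightarrow> bool" where
  "restricted_expansion F f \<longleftrightarrow> restricted F \<and>
     (\<forall>t. adic_sums (of_nat CARD('p)) (\<lambda>n. fps_nth F n * t ^ n) (f t))"

text \<open>
  Weierstrass preparation F = p^s W V in the ring of restricted power series, i.e. on the closed
  unit disc: the distinguished (Weierstrass) polynomial W is a monic polynomial with p-adic integer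
  coefficients.  The lower coefficients need not be divisible by p; that stronger condition belongs
  to the ring of all formal power series, i.e. to the open unit disc.
\<close>

definition weierstrass_preparation ::
  "'p::prime_card padic_int fps \<Rightarrow> nat \<Rightarrow> 'p padic_int poly \<Rightarrow> 'p padic_int fps \<Rightarrow> bool" where
  "weierstrass_preparation F s W V \<longleftrightarrow> lead_coeff W = 1 \<and> restricted_unit V \<and>
     F = fps_const (of_nat CARD('p) ^ s) * fps_of_poly W * V"

end

theory Submission
  imports Defs
begin

text \<open>
  Put c k = Tr (y U^k) and q k = p^k / k!, a p-adic integer.  The binomial series gives
  F(t) = sum_k c k * q k * t (t - 1) ... (t - k + 1).  The powers 1, \<omega>, ..., \<omega>^(r-1) span E, so
  the hypothesis on x yields j < r such that p does not divide c j.  As v(k!) \<le> (k - 1) / (p - 1),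
  the number q k is divisible by p^(min k (p-1)), and j < r \<le> p - 1.  Hence the coefficient of t^j
  in F has valuation exactly j, while the coefficients of t^n with n \<ge> r have valuation at least
  r > j.  In a factorisation F = p^s W V the unit V is a constant modulo p, so the coefficient of
  t^(deg W) has valuation exactly s, which is minimal among all coefficients; this forces
  s \<le> j and deg W < r.
\<close>

section \<open>Completeness and units of the p-adic integers\<close>

text \<open>The claim concerns every restricted expansion of f and every factorisation of it. A
  restricted series is determined by its values, so it is enough to study one series: the Newton
  series of f rewritten in powers of t. This rewriting converges because 2 v(k!) \<le> k - 1 for k >
  0 makes q k tend to 0. The sharper bound by min k (p-1) separates the coefficients, and p > r puts
  both j + 1 and r in the range where it applies.

  The powers of \<omega> below r span E because the first power that depends linearly on the lower
  ones makes their span stable under multiplication by \<omega>. Coordinates in a basis of A reduce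
  modulo p, which ties the trace on A/pA to the trace on A: Tr (x \<omega>^j) \<noteq> 0 says
  exactly that p does not divide c j.

  A is given only through a basis over the p-adic integers, so the completeness and separatedness
  that give the binomial series a value are checked in coordinates. Zeros are counted through W: by
  p^s W = F V^-1 every zero of f is a root of W, and its multiplicity is its order there.\<close>

abbreviation residue_char :: "'p::prime_card padic_int" where
  "residue_char \<equiv> of_nat CARD('p)"

lemma padic_int_eq_iff: "x = y \<longleftrightarrow> (\<forall>n. Rep_padic_int x n = Rep_padic_int y n)"
  by (auto simp: Rep_padic_int_inject[symmetric] fun_eq_iff)

lemma Rep_padic_int_mod [simp]:
  "Rep_padic_int (x :: 'p::prime_card padic_int) n mod int CARD('p) ^ n = Rep_padic_int x n"
  using Rep_padic_int_add_mod[of x n 0] by simp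

lemma Rep_padic_int_mod_le:
  "n \<le> m \<Longrightarrow> Rep_padic_int (x :: 'p::prime_card padic_int) m mod int CARD('p) ^ n = Rep_padic_int x n"
  using Rep_padic_int_add_mod[of x n "m - n"] by simp

lemma Rep_padic_int_of_nat_power:
  "Rep_padic_int (residue_char ^ m :: 'p::prime_card padic_int) n
     = int CARD('p) ^ m mod int CARD('p) ^ n"
  using Rep_padic_int_of_nat[of "CARD('p) ^ m" n, where 'p = 'p] by simp

lemma residue_char_power_dvd_iff:
  fixes x :: "'p::prime_card padic_int"
  shows "residue_char ^ m dvd x \<longleftrightarrow> Rep_padic_int x m = 0"
proof
  assume "residue_char ^ m dvd x"
  then obtain c where "x = residue_char ^ m * c" by blast
  then show "Rep_padic_int x m = 0"
    by (simp add: times_padic_int.rep_eq Rep_padic_int_of_nat_power)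
next
  let ?q = "int CARD('p)"
  assume x: "Rep_padic_int x m = 0"
  have q: "?q ^ m > 0" using prime_card_int[where 'a = 'p] by (simp add: prime_gt_0_int)
  \<comment> \<open>The quotient modulo p^n depends on x modulo p^(n+m), hence the shift of the
    index.\<close>
  define y where "y = (\<lambda>n. Rep_padic_int x (n + m) div ?q ^ m)"
  have "y (Suc n) mod ?q ^ n = y n" for n
  proof -
    have "Rep_padic_int x (n + m) = Rep_padic_int x (Suc n + m) mod (?q ^ m * ?q ^ n)"
      using Rep_padic_int_Suc_mod[of x "n + m"] by (simp add: power_add mult.commute)
    also have "\<dots> = ?q ^ m * (y (Suc n) mod ?q ^ n) + Rep_padic_int x (Suc n + m) mod ?q ^ m"
      unfolding y_def by (rule zmod_zmult2_eq) simp
    also have "Rep_padic_int x (Suc n + m) mod ?q ^ m = 0"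
      using Rep_padic_int_mod_le[of m "Suc n + m" x] x by simp
    finally show ?thesis using q by (simp add: y_def)
  qed
  then have y: "Rep_padic_int (Abs_padic_int y :: 'p padic_int) = y"
    by (intro Abs_padic_int_inverse) simp
  have "x = residue_char ^ m * Abs_padic_int y"
    unfolding padic_int_eq_iff
  proof
    fix n
    have "?q ^ m dvd Rep_padic_int x (n + m)"
      using Rep_padic_int_mod_le[of m "n + m" x] x by (simp add: dvd_eq_mod_eq_0)
    then have "?q ^ m * y n = Rep_padic_int x (n + m)" by (simp add: y_def)
    then show "Rep_padic_int x n = Rep_padic_int (residue_char ^ m * Abs_padic_int y :: 'p padic_int) n"
      using Rep_padic_int_mod_le[of n "n + m" x]
      by (simp add: times_padic_int.rep_eq Rep_padic_int_of_nat_power y mod_simps)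
  qed
  then show "residue_char ^ m dvd x" by (rule dvdI)
qed

lemma padic_int_eq_0I:
  fixes x :: "'p::prime_card padic_int"
  assumes "\<And>m. residue_char ^ m dvd x"
  shows "x = 0"
  using assms by (simp add: residue_char_power_dvd_iff padic_int_eq_iff zero_padic_int.rep_eq)

lemma residue_char_power_dvd_diff_iff:
  fixes x y :: "'p::prime_card padic_int"
  shows "residue_char ^ m dvd x - y \<longleftrightarrow> Rep_padic_int x m = Rep_padic_int y m"
  using mod_eq_dvd_iff[of "Rep_padic_int x m" "int CARD('p) ^ m" "Rep_padic_int y m"]
  by (simp add: residue_char_power_dvd_iff minus_padic_int.rep_eq dvd_eq_mod_eq_0)

lemma dvd_diff_if_dvd_steps:
  fixes X :: "nat \<Rightarrow> 'b::comm_ring_1"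
  assumes "\<And>N. N \<ge> N0 \<Longrightarrow> q dvd X (Suc N) - X N" and "N0 \<le> M" "M \<le> N"
  shows "q dvd X N - X M"
  using \<open>M \<le> N\<close>
proof (induction N rule: dec_induct)
  case (step N)
  then have "q dvd (X (Suc N) - X N) + (X N - X M)"
    using assms(1)[of N] \<open>N0 \<le> M\<close> by (intro dvd_add) auto
  then show ?case by simp
qed simp

text \<open>For an ultrametric, small consecutive differences already make a Cauchy sequence, and
  the limit inherits the explicit modulus \<open>N0\<close>. Later limits of series and in algebras
  rest on keeping this modulus.\<close>

lemma padic_int_complete:
  fixes X :: "nat \<Rightarrow> 'p::prime_card padic_int"
  assumes X: "\<And>m N. N \<ge> N0 m \<Longrightarrow> residue_char ^ m dvd X (Suc N) - X N"
  obtains L where "\<And>m N. N \<ge> N0 m \<Longrightarrow> residue_char ^ m dvd X N - L"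
proof -
  \<comment> \<open>\<open>N0\<close> may fail to be monotone. Its partial sums dominate it and are
    monotone, so the components n and n + 1 read from \<open>X (M n)\<close> and
    \<open>X (M (Suc n))\<close> are compatible.\<close>
  define M where "M n = (\<Sum>i\<le>n. N0 i)" for n
  have M: "N0 n \<le> M n" "M n \<le> M (Suc n)" for n
    unfolding M_def by (auto intro: member_le_sum)
  have *: "Rep_padic_int (X N) m = Rep_padic_int (X N') m" if "N \<ge> N0 m" "N' \<ge> N0 m" for N N' m
  proof -
    have "Rep_padic_int (X N) m = Rep_padic_int (X (N0 m)) m" if "N \<ge> N0 m" for N
      using dvd_diff_if_dvd_steps[of "N0 m" "residue_char ^ m" X "N0 m" N] X that
      by (simp add: residue_char_power_dvd_diff_iff)
    with that show ?thesis by metis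
  qed
  define y where "y n = Rep_padic_int (X (M n)) n" for n
  have "y (Suc n) mod int CARD('p) ^ n = y n" for n
    unfolding y_def Rep_padic_int_Suc_mod
    by (rule *) (use M[of n] in linarith)+
  then have y: "Rep_padic_int (Abs_padic_int y :: 'p padic_int) = y"
    by (intro Abs_padic_int_inverse) simp
  show thesis
  proof (rule that)
    fix m N assume "N \<ge> N0 m"
    then show "residue_char ^ m dvd X N - Abs_padic_int y"
      unfolding residue_char_power_dvd_diff_iff y unfolding y_def by (rule *) (rule M)
  qed
qed

section \<open>The residue map onto the field with p elements, and units\<close>

definition reduce :: "'p::prime_card padic_int \<Rightarrow> 'p mod_ring" where
  "reduce x = of_int (Rep_padic_int x 1)"

lemma of_int_mod_card: "(of_int (k mod int CARD('p)) :: 'p::prime_card mod_ring) = of_int k"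
  using of_int_mod_CHAR[of k, where 'a = "'p mod_ring"] by simp

lemma reduce_simps [simp]:
  "reduce 0 = 0" "reduce 1 = 1" "reduce (x + y) = reduce x + reduce y"
  "reduce (x - y) = reduce x - reduce y" "reduce (x * y) = reduce x * reduce y"
  by (simp_all add: reduce_def zero_padic_int.rep_eq one_padic_int.rep_eq plus_padic_int.rep_eq
      minus_padic_int.rep_eq times_padic_int.rep_eq of_int_mod_card)

lemma reduce_sum: "reduce (sum g A) = (\<Sum>a\<in>A. reduce (g a))"
  by (induction A rule: infinite_finite_induct) simp_all

lemma reduce_of_nat [simp]: "reduce (of_nat n) = of_nat n"
  by (induction n) simp_all

lemma reduce_of_int [simp]: "reduce (of_int n) = of_int n"
  by (cases n) (simp_all del: of_nat_Suc add: reduce_simps(4)[of 0, simplified])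

lemma reduce_eq_0_iff: "reduce (x :: 'p::prime_card padic_int) = 0 \<longleftrightarrow> residue_char dvd x"
proof
  assume "residue_char dvd x"
  then show "reduce x = 0" by (auto elim!: dvdE)
next
  assume "reduce x = 0"
  moreover have "0 \<le> Rep_padic_int x 1" "Rep_padic_int x 1 < int CARD('p)"
    using Rep_padic_int_mod[of x 1] prime_gt_0_int[OF prime_card_int[where 'a = 'p]]
    by (metis pos_mod_sign pos_mod_bound power_one_right)+
  ultimately have "Rep_padic_int x 1 = 0"
    unfolding reduce_def of_int_of_int_mod_ring
    by (metis to_int_mod_ring_of_int_mod_ring of_int_0 of_int_of_int_mod_ring
        order_refl prime_card_int prime_gt_0_int)
  then show "residue_char dvd x" using residue_char_power_dvd_iff[of 1 x] by simp
qed

lemma residue_char_dvd_mult: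
  fixes x y :: "'p::prime_card padic_int"
  shows "residue_char dvd x * y \<longleftrightarrow> residue_char dvd x \<or> residue_char dvd y"
  by (simp flip: reduce_eq_0_iff)

lemma reduce_lift: "\<exists>c. reduce c = (d :: 'p::prime_card mod_ring)"
proof
  show "reduce (of_int (to_int_mod_ring d)) = d"
    by (simp add: of_int_of_int_mod_ring)
qed

text \<open>If c lifts the inverse of the residue of x, then x c = 1 - z with p dividing z. The
  inverse is c times the geometric series in z, which converges p-adically.\<close>

lemma padic_unitI:
  fixes x :: "'p::prime_card padic_int"
  assumes "\<not> residue_char dvd x"
  obtains y where "x * y = 1"
proof -
  obtain c :: "'p padic_int" where c: "reduce c = inverse (reduce x)" using reduce_lift by blast
  define z where "z = 1 - x * c"
  have "reduce z = 0" using assms by (simp add: z_def c reduce_eq_0_iff)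
  then have z: "residue_char dvd z" by (simp add: reduce_eq_0_iff)
  have "residue_char ^ m dvd (\<Sum>k<Suc N. c * z ^ k) - (\<Sum>k<N. c * z ^ k)" if "N \<ge> m" for m N
    using dvd_power_same[OF z, of N] le_imp_power_dvd[OF that, of residue_char]
    by (auto intro: dvd_trans dvd_mult)
  then obtain y where y: "\<And>m N. N \<ge> m \<Longrightarrow> residue_char ^ m dvd (\<Sum>k<N. c * z ^ k) - y"
    using padic_int_complete[of "\<lambda>m. m" "\<lambda>N. \<Sum>k<N. c * z ^ k"] by metis
  have "x * y - 1 = 0"
  proof (rule padic_int_eq_0I)
    fix m
    have "(\<Sum>k<m. c * z ^ k) = c * (\<Sum>k<m. z ^ k)" by (simp add: sum_distrib_left)
    then have "x * (\<Sum>k<m. c * z ^ k) = 1 - z ^ m"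
      using one_diff_power_eq[of z m] by (simp add: z_def algebra_simps)
    then have "x * y - 1 = - (x * ((\<Sum>k<m. c * z ^ k) - y)) - z ^ m"
      by (simp add: right_diff_distrib)
    moreover have "residue_char ^ m dvd - (x * ((\<Sum>k<m. c * z ^ k) - y)) - z ^ m"
      using y[of m m] dvd_power_same[OF z, of m] by (intro dvd_diff) (simp_all add: dvd_minus_iff)
    ultimately show "residue_char ^ m dvd x * y - 1" by simp
  qed
  then show thesis by (intro that) simp
qed

section \<open>Restricted power series\<close>

lemma fps_residue_char_power_dvd_iff:
  fixes F :: "'p::prime_card padic_int fps"
  shows "of_nat CARD('p) ^ m dvd F \<longleftrightarrow> (\<forall>n. residue_char ^ m dvd fps_nth F n)"
proof -
  have eq: "(of_nat CARD('p) ^ m :: 'p padic_int fps) = fps_const (residue_char ^ m)"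
    by (simp flip: fps_of_nat fps_const_power)
  show ?thesis
  proof
    assume "of_nat CARD('p) ^ m dvd F"
    then show "\<forall>n. residue_char ^ m dvd fps_nth F n" unfolding eq by (auto elim!: dvdE)
  next
    assume "\<forall>n. residue_char ^ m dvd fps_nth F n"
    then obtain c where "\<And>n. fps_nth F n = residue_char ^ m * c n" unfolding dvd_def by metis
    then have "F = fps_const (residue_char ^ m) * Abs_fps c" by (simp add: fps_eq_iff)
    then show "of_nat CARD('p) ^ m dvd F" unfolding eq by (rule dvdI)
  qed
qed

lemma fps_residue_char_dvd_iff:
  fixes F :: "'p::prime_card padic_int fps"
  shows "of_nat CARD('p) dvd F \<longleftrightarrow> (\<forall>n. residue_char dvd fps_nth F n)"
  using fps_residue_char_power_dvd_iff[of 1 F] by simp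

lemma fps_padic_eq_0I:
  fixes F :: "'p::prime_card padic_int fps"
  assumes "\<And>m. of_nat CARD('p) ^ m dvd F"
  shows "F = 0"
  using assms unfolding fps_residue_char_power_dvd_iff
  by (auto simp: fps_eq_iff intro: padic_int_eq_0I)

lemma coeff_sum_monom: "coeff (\<Sum>i<N. monom (c i) i) n = (if n < N then c n else 0)"
  by (simp add: coeff_sum if_distrib cong: if_cong)

text \<open>Restricted series are the p-adic closure of the polynomials. In this form, closure under
  sums, products and limits is inherited from polynomials.\<close>

lemma restricted_iff_approx_poly:
  fixes F :: "'p::prime_card padic_int fps"
  shows "restricted F \<longleftrightarrow> (\<forall>m. \<exists>g. of_nat CARD('p) ^ m dvd F - fps_of_poly g)"
proof
  assume F: "restricted F"
  show "\<forall>m. \<exists>g. of_nat CARD('p) ^ m dvd F - fps_of_poly g"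
  proof
    fix m
    obtain N where "\<forall>n\<ge>N. residue_char ^ m dvd fps_nth F n"
      using F unfolding restricted_def adic_tendsto_def eventually_sequentially by auto
    then have "of_nat CARD('p) ^ m dvd F - fps_of_poly (\<Sum>i<N. monom (fps_nth F i) i)"
      by (auto simp: fps_residue_char_power_dvd_iff coeff_sum_monom)
    then show "\<exists>g. of_nat CARD('p) ^ m dvd F - fps_of_poly g" ..
  qed
next
  assume *: "\<forall>m. \<exists>g. of_nat CARD('p) ^ m dvd F - fps_of_poly g"
  show "restricted F"
    unfolding restricted_def adic_tendsto_def eventually_sequentially
  proof
    fix m
    obtain g where g: "of_nat CARD('p) ^ m dvd F - fps_of_poly g" using * by blast
    have "residue_char ^ m dvd fps_nth F n - 0" if "n \<ge> Suc (degree g)" for n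
      using g[unfolded fps_residue_char_power_dvd_iff, rule_format, of n] that
      by (simp add: coeff_eq_0)
    then show "\<exists>N. \<forall>n\<ge>N. residue_char ^ m dvd fps_nth F n - 0" by blast
  qed
qed

lemma restricted_fps_of_poly [simp]: "restricted (fps_of_poly g)"
  unfolding restricted_iff_approx_poly by (metis diff_self dvd_0_right)

lemma restricted_add:
  fixes F :: "'p::prime_card padic_int fps"
  assumes "restricted F" "restricted G"
  shows "restricted (F + G)"
  unfolding restricted_iff_approx_poly
proof
  fix m
  obtain f g where "of_nat CARD('p) ^ m dvd F - fps_of_poly f"
    and "of_nat CARD('p) ^ m dvd G - fps_of_poly g"
    using assms unfolding restricted_iff_approx_poly by metis
  then have "of_nat CARD('p) ^ m dvd (F - fps_of_poly f) + (G - fps_of_poly g)" by (rule dvd_add)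
  also have "\<dots> = F + G - fps_of_poly (f + g)" by (simp add: fps_of_poly_add)
  finally show "\<exists>g. of_nat CARD('p) ^ m dvd F + G - fps_of_poly g" by blast
qed

lemma restricted_mult:
  fixes F :: "'p::prime_card padic_int fps"
  assumes "restricted F" "restricted G"
  shows "restricted (F * G)"
  unfolding restricted_iff_approx_poly
proof
  fix m
  obtain f g where "of_nat CARD('p) ^ m dvd F - fps_of_poly f"
    and "of_nat CARD('p) ^ m dvd G - fps_of_poly g"
    using assms unfolding restricted_iff_approx_poly by metis
  then have "of_nat CARD('p) ^ m dvd (F - fps_of_poly f) * G + fps_of_poly f * (G - fps_of_poly g)"
    by (intro dvd_add) auto
  also have "\<dots> = F * G - fps_of_poly (f * g)" by (simp add: fps_of_poly_mult algebra_simps)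
  finally show "\<exists>g. of_nat CARD('p) ^ m dvd F * G - fps_of_poly g" by blast
qed

lemma restricted_const [simp]: "restricted (fps_const c)"
  using restricted_fps_of_poly[of "[:c:]"] by (simp add: fps_of_poly_const)

lemma restricted_of_nat_power [simp]: "restricted (of_nat n ^ m)"
  using restricted_const[of "of_nat n ^ m"] by (simp flip: fps_of_nat fps_const_power)

lemma restricted_1 [simp]: "restricted 1"
  using restricted_const[of 1] by simp

lemma restricted_diff:
  assumes "restricted F" "restricted G"
  shows "restricted (F - G)"
proof -
  have "restricted (F + fps_const (- 1) * G)" using assms by (intro restricted_add restricted_mult) auto
  then show ?thesis by (simp flip: fps_const_neg)
qed

lemma restricted_power: "restricted F \<Longrightarrow> restricted (F ^ n)"
  by (induction n) (auto intro: restricted_mult)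

lemma restricted_sum:
  assumes "\<And>i. i \<in> A \<Longrightarrow> restricted (F i)"
  shows "restricted (sum F A)"
  using assms
  by (induction A rule: infinite_finite_induct)
     (auto intro: restricted_add simp: restricted_const[of 0, simplified])

lemma fps_nth_residue_char_power_mult:
  "fps_nth (of_nat CARD('p) ^ s * F) n
     = residue_char ^ s * fps_nth (F :: 'p::prime_card padic_int fps) n"
proof -
  have "(of_nat CARD('p) ^ s :: 'p padic_int fps) = fps_const (residue_char ^ s)"
    by (simp flip: fps_of_nat fps_const_power)
  then show ?thesis by simp
qed

lemma restricted_cancel_residue_char:
  fixes F :: "'p::prime_card padic_int fps"
  assumes "restricted (of_nat CARD('p) ^ s * F)"
  shows "restricted F"
  unfolding restricted_def adic_tendsto_def
proof
  fix m
  have "\<forall>\<^sub>F n in sequentially. residue_char ^ (s + m) dvd residue_char ^ s * fps_nth F n - 0"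
    \<comment> \<open>Precision m for \<open>F\<close> is read off from precision s + m for its
      multiple.\<close>
    using assms unfolding restricted_def adic_tendsto_def fps_nth_residue_char_power_mult by blast
  then show "\<forall>\<^sub>F n in sequentially. residue_char ^ m dvd fps_nth F n - 0"
    by (rule eventually_mono) (simp add: power_add)
qed

text \<open>The modulus \<open>N0\<close> is common to all coefficients, so the coefficientwise
  limit is uniform: a polynomial close to \<open>X (N0 m)\<close> is equally close to the limit,
  which is therefore restricted.\<close>

lemma restricted_complete:
  fixes X :: "nat \<Rightarrow> 'p::prime_card padic_int fps"
  assumes X: "\<And>m N. N \<ge> N0 m \<Longrightarrow> of_nat CARD('p) ^ m dvd X (Suc N) - X N"
    and "\<And>N. restricted (X N)"
  obtains S where "restricted S" "\<And>m N. N \<ge> N0 m \<Longrightarrow> of_nat CARD('p) ^ m dvd X N - S"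
proof -
  have "\<exists>L. \<forall>m N. N \<ge> N0 m \<longrightarrow> residue_char ^ m dvd fps_nth (X N) n - L" for n
  proof -
    have "residue_char ^ m dvd fps_nth (X (Suc N)) n - fps_nth (X N) n" if "N \<ge> N0 m" for m N
      using X[OF that] by (simp add: fps_residue_char_power_dvd_iff)
    then show ?thesis using padic_int_complete[of N0 "\<lambda>N. fps_nth (X N) n"] by metis
  qed
  then obtain c where "\<And>n m N. N \<ge> N0 m \<Longrightarrow> residue_char ^ m dvd fps_nth (X N) n - c n" by metis
  then have S: "of_nat CARD('p) ^ m dvd X N - Abs_fps c" if "N \<ge> N0 m" for m N
    using that by (simp add: fps_residue_char_power_dvd_iff)
  have "restricted (Abs_fps c)"
    unfolding restricted_iff_approx_poly
  proof
    fix m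
    obtain g where "of_nat CARD('p) ^ m dvd X (N0 m) - fps_of_poly g"
      using assms(2) unfolding restricted_iff_approx_poly by metis
    from dvd_diff[OF this S[of m "N0 m"]]
    have "of_nat CARD('p) ^ m dvd Abs_fps c - fps_of_poly g" by simp
    then show "\<exists>g. of_nat CARD('p) ^ m dvd Abs_fps c - fps_of_poly g" ..
  qed
  with S show thesis by (rule that[rotated])
qed

text \<open>The weights p^k make any sequence of restricted series summable. Inverses of units and
  the quotient and remainder of Weierstrass division are all obtained as such sums.\<close>

lemma restricted_power_series_in_residue_char:
  fixes h :: "nat \<Rightarrow> 'p::prime_card padic_int fps"
  assumes "\<And>k. restricted (h k)"
  obtains S where "restricted S"
    "\<And>m. of_nat CARD('p) ^ m dvd (\<Sum>k<m. of_nat CARD('p) ^ k * h k) - S"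
proof -
  let ?X = "\<lambda>N. \<Sum>k<N. of_nat CARD('p) ^ k * h k"
  have "of_nat CARD('p) ^ m dvd ?X (Suc N) - ?X N" if "m \<le> N" for m N
    using le_imp_power_dvd[OF that, of "of_nat CARD('p) :: 'p padic_int fps"] by simp
  moreover have "restricted (?X N)" for N
    using assms by (intro restricted_sum restricted_mult) simp_all
  ultimately obtain S where "restricted S" "\<And>m N. N \<ge> m \<Longrightarrow> of_nat CARD('p) ^ m dvd ?X N - S"
    using restricted_complete[of "\<lambda>m. m" ?X] by blast
  then show thesis using that order_refl by blast
qed

text \<open>Here m and d are the degrees of the reductions modulo p. Over a field the leading
  coefficients multiply to a nonzero one, so degrees modulo p add.\<close>

lemma residue_char_not_dvd_mult_nth:
  fixes F G :: "'p::prime_card padic_int fps"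
  assumes "\<not> residue_char dvd fps_nth F m" "\<And>n. n > m \<Longrightarrow> residue_char dvd fps_nth F n"
    and "\<not> residue_char dvd fps_nth G d" "\<And>n. n > d \<Longrightarrow> residue_char dvd fps_nth G n"
  shows "\<not> residue_char dvd fps_nth (F * G) (m + d)"
proof -
  have "fps_nth (F * G) (m + d) = (\<Sum>i=0..m+d. fps_nth F i * fps_nth G (m + d - i))"
    by (rule fps_mult_nth)
  also have "\<dots> = fps_nth F m * fps_nth G d
      + (\<Sum>i\<in>{0..m+d}-{m}. fps_nth F i * fps_nth G (m + d - i))"
    by (subst sum.remove[of _ m]) auto
  finally have eq: "fps_nth (F * G) (m + d) = fps_nth F m * fps_nth G d
      + (\<Sum>i\<in>{0..m+d}-{m}. fps_nth F i * fps_nth G (m + d - i))" .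
  have "residue_char dvd (\<Sum>i\<in>{0..m+d}-{m}. fps_nth F i * fps_nth G (m + d - i))"
  proof (rule dvd_sum)
    fix i assume "i \<in> {0..m+d} - {m}"
    then have "i > m \<or> m + d - i > d" by auto
    then show "residue_char dvd fps_nth F i * fps_nth G (m + d - i)"
      using assms(2,4) by (auto simp: residue_char_dvd_mult)
  qed
  then show ?thesis
    unfolding eq using assms(1,3) by (simp add: dvd_add_left_iff residue_char_dvd_mult)
qed

lemma restricted_reduced_degree:
  fixes F :: "'p::prime_card padic_int fps"
  assumes "restricted F" "\<not> of_nat CARD('p) dvd F"
  obtains d where "\<not> residue_char dvd fps_nth F d" "\<And>n. n > d \<Longrightarrow> residue_char dvd fps_nth F n"
proof -
  let ?A = "{n. \<not> residue_char dvd fps_nth F n}"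
  obtain N where "\<forall>n\<ge>N. residue_char ^ 1 dvd fps_nth F n - 0"
    using assms(1) unfolding restricted_def adic_tendsto_def eventually_sequentially by blast
  then have "?A \<subseteq> {..<N}" by (auto simp: not_le[symmetric])
  then have fin: "finite ?A" by (rule finite_subset) simp
  moreover have "?A \<noteq> {}" using assms(2) by (auto simp: fps_residue_char_dvd_iff)
  ultimately have "Max ?A \<in> ?A" by (rule Max_in)
  moreover have "residue_char dvd fps_nth F n" if "n > Max ?A" for n
    using Max_ge[OF fin, of n] that by auto
  ultimately show thesis using that[of "Max ?A"] by blast
qed

text \<open>A unit reduces to a unit of a polynomial ring over a field, hence to a nonzero constant.
  Conversely, scaling by an inverse of the constant term turns V into 1 - p h, whose inverse is the
  geometric series in p h.\<close>

lemma restricted_unit_iff: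
  fixes V :: "'p::prime_card padic_int fps"
  shows "restricted_unit V \<longleftrightarrow> restricted V \<and> \<not> residue_char dvd fps_nth V 0
    \<and> (\<forall>n>0. residue_char dvd fps_nth V n)"
proof
  assume "restricted_unit V"
  then obtain V' where V: "restricted V" "restricted V'" and VV: "V * V' = 1"
    unfolding restricted_unit_def by blast
  have one: "\<not> residue_char dvd (1 :: 'p padic_int)" by (simp flip: reduce_eq_0_iff)
  then have "\<not> of_nat CARD('p) dvd (1 :: 'p padic_int fps)"
    by (auto simp: fps_residue_char_dvd_iff intro!: exI[of _ 0])
  then have nd: "\<not> of_nat CARD('p) dvd V" "\<not> of_nat CARD('p) dvd V'"
    using VV by (metis dvd_mult2, metis dvd_mult)
  obtain m where m: "\<not> residue_char dvd fps_nth V m" "\<And>n. n > m \<Longrightarrow> residue_char dvd fps_nth V n"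
    using restricted_reduced_degree[OF V(1) nd(1)] by blast
  obtain d where d: "\<not> residue_char dvd fps_nth V' d" "\<And>n. n > d \<Longrightarrow> residue_char dvd fps_nth V' n"
    using restricted_reduced_degree[OF V(2) nd(2)] by blast
  have "\<not> residue_char dvd fps_nth (V * V') (m + d)"
    using m d by (rule residue_char_not_dvd_mult_nth)
  then have "m = 0" by (auto simp: VV fps_one_nth split: if_splits)
  with m V show "restricted V \<and> \<not> residue_char dvd fps_nth V 0
    \<and> (\<forall>n>0. residue_char dvd fps_nth V n)" by auto
next
  assume V: "restricted V \<and> \<not> residue_char dvd fps_nth V 0
    \<and> (\<forall>n>0. residue_char dvd fps_nth V n)"
  then obtain u where u: "fps_nth V 0 * u = 1" using padic_unitI by blast
  define z where "z = 1 - fps_const u * V"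
  have "residue_char dvd fps_nth z n" for n
    using V u by (cases "n = 0") (auto simp: z_def mult.commute)
  then have "of_nat CARD('p) dvd z" by (simp add: fps_residue_char_dvd_iff)
  then obtain h where h: "z = of_nat CARD('p) * h" by blast
  \<comment> \<open>The geometric series stays in the restricted ring only if h does; this follows
    by cancelling p.\<close>
  have "restricted (of_nat CARD('p) ^ 1 * h)"
    using V unfolding power_one_right h[symmetric] z_def
    by (intro restricted_diff restricted_mult) simp_all
  then have "restricted h" by (rule restricted_cancel_residue_char)
  then obtain S where S: "restricted S"
    "\<And>m. of_nat CARD('p) ^ m dvd (\<Sum>k<m. of_nat CARD('p) ^ k * h ^ k) - S"
    using restricted_power_series_in_residue_char[of "\<lambda>k. h ^ k"] restricted_power by blast
  have "(1 - z) * S - 1 = 0"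
  proof (rule fps_padic_eq_0I)
    fix m
    have "(1 - z) * (\<Sum>k<m. of_nat CARD('p) ^ k * h ^ k) = 1 - of_nat CARD('p) ^ m * h ^ m"
      using one_diff_power_eq[of z m] by (simp add: h power_mult_distrib)
    then have "(1 - z) * S - 1 = - (of_nat CARD('p) ^ m * h ^ m)
        - (1 - z) * ((\<Sum>k<m. of_nat CARD('p) ^ k * h ^ k) - S)"
      by (simp add: right_diff_distrib)
    then show "of_nat CARD('p) ^ m dvd (1 - z) * S - 1"
      using S(2)[of m] by (auto intro!: dvd_diff)
  qed
  then have "V * (fps_const u * S) = 1" by (simp add: z_def mult_ac)
  moreover have "restricted (fps_const u * S)" using S(1) by (intro restricted_mult) simp_all
  ultimately show "restricted_unit V" using V unfolding restricted_unit_def by blast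
qed

section \<open>Weierstrass division and preparation\<close>

text \<open>Long division: each step cancels the top coefficient of f with the help of the inverse
  u. The remainder is bounded through its coefficients rather than its degree, so that d = 0
  correctly forces it to vanish.\<close>

lemma poly_division_by_unit_lead_coeff:
  fixes f g :: "'a::comm_ring_1 poly"
  assumes "degree g \<le> d" "coeff g d * u = 1"
  shows "\<exists>q r. f = q * g + r \<and> (\<forall>n\<ge>d. coeff r n = 0)"
proof -
  have "\<exists>q r. f = q * g + r \<and> (\<forall>n\<ge>d. coeff r n = 0)" if "\<forall>i\<ge>d + k. coeff f i = 0" for k f
    using that
  proof (induction k arbitrary: f)
    case 0
    then show ?case by (intro exI[of _ 0] exI[of _ f]) simp
  next
    case (Suc k)
    define f' where "f' = f - monom (coeff f (d + k) * u) k * g"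
    have "coeff f' i = 0" if "i \<ge> d + k" for i
    proof (cases "i = d + k")
      case True
      then show ?thesis using assms(2) by (simp add: f'_def coeff_monom_mult mult.assoc mult.commute[of u])
    next
      case False
      with that have "coeff f i = 0" "coeff g (i - k) = 0"
        using Suc.prems assms(1) by (auto intro!: coeff_eq_0)
      then show ?thesis by (simp add: f'_def coeff_monom_mult)
    qed
    then obtain q r where "f' = q * g + r" "\<forall>n\<ge>d. coeff r n = 0" using Suc.IH by blast
    then show ?case
      by (intro exI[of _ "q + monom (coeff f (d + k) * u) k"] exI[of _ r])
         (simp add: f'_def algebra_simps)
  qed
  from this[of "Suc (degree f)" f] show ?thesis by (simp add: coeff_eq_0)
qed

text \<open>
  Modulo p the divisor is a polynomial with invertible leading coefficient, so division with
  remainder is possible modulo p; iterating on the error term gives the quotient p-adically.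
\<close>

lemma weierstrass_division:
  fixes f G :: "'p::prime_card padic_int fps"
  assumes "restricted f" "restricted G"
    and d: "\<not> residue_char dvd fps_nth G d" "\<And>n. n > d \<Longrightarrow> residue_char dvd fps_nth G n"
  obtains q r where "f = q * G + r" "restricted q" "\<And>n. n \<ge> d \<Longrightarrow> fps_nth r n = 0"
proof -
  let ?p = "of_nat CARD('p) :: 'p padic_int fps"
  define g where "g = (\<Sum>i<Suc d. monom (fps_nth G i) i)"
  have "?p dvd G - fps_of_poly g"
    using d(2) unfolding fps_residue_char_dvd_iff g_def by (auto simp: coeff_sum_monom)
  then obtain H where H: "G = fps_of_poly g + ?p * H" by (auto elim!: dvdE simp: algebra_simps)
  obtain u where u: "fps_nth G d * u = 1" using padic_unitI[OF d(1)] by blast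
  have "degree g \<le> d" unfolding g_def coeff_sum_monom by (rule degree_le) (simp add: coeff_sum_monom)
  moreover have "coeff g d * u = 1" using u unfolding g_def coeff_sum_monom by simp
  ultimately have division: "\<exists>q r. h = q * g + r \<and> (\<forall>n\<ge>d. coeff r n = 0)" for h
    by (rule poly_division_by_unit_lead_coeff)
  have step: "\<exists>q r f'. f = q * G + r + ?p * f' \<and> restricted q \<and> (\<forall>n\<ge>d. fps_nth r n = 0)
      \<and> restricted r \<and> restricted f'" if f: "restricted f" for f
  proof -
    obtain h where "?p ^ 1 dvd f - fps_of_poly h"
      using f unfolding restricted_iff_approx_poly by blast
    then obtain f1 where f1: "f = fps_of_poly h + ?p * f1" by (auto elim!: dvdE simp: algebra_simps)
    obtain q r where qr: "h = q * g + r" "\<forall>n\<ge>d. coeff r n = 0" using division by blast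
    define f' where "f' = f1 - fps_of_poly q * H"
    have eq: "f = fps_of_poly q * G + fps_of_poly r + ?p * f'"
      unfolding f1 qr(1) H f'_def by (simp add: fps_of_poly_add fps_of_poly_mult algebra_simps)
    have "restricted (f - fps_of_poly q * G - fps_of_poly r)"
      using f \<open>restricted G\<close> by (intro restricted_diff restricted_mult) simp_all
    then have "restricted (?p ^ 1 * f')" unfolding eq by simp
    then have "restricted f'" by (rule restricted_cancel_residue_char)
    then show ?thesis
      using eq qr(2)
      by (intro exI[of _ "fps_of_poly q"] exI[of _ "fps_of_poly r"] exI[of _ f']) simp
  qed
  then obtain Q R E where QRE: "\<And>f. restricted f \<Longrightarrow> f = Q f * G + R f + ?p * E f"
    "\<And>f. restricted f \<Longrightarrow> restricted (Q f)" "\<And>f n. restricted f \<Longrightarrow> n \<ge> d \<Longrightarrow> fps_nth (R f) n = 0"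
    "\<And>f. restricted f \<Longrightarrow> restricted (R f)" "\<And>f. restricted f \<Longrightarrow> restricted (E f)"
    by metis
  \<comment> \<open>\<open>e k\<close> is the error left after k rounds of division. It enters with
    weight p^k, which makes the quotients and remainders of the rounds sum to limits.\<close>
  define e where "e k = (E ^^ k) f" for k
  have e: "restricted (e k)" for k
    by (induction k) (auto simp: e_def assms(1) QRE)
  have partial: "f = (\<Sum>k<m. ?p ^ k * Q (e k)) * G + (\<Sum>k<m. ?p ^ k * R (e k)) + ?p ^ m * e m" for m
  proof (induction m)
    case 0
    then show ?case by (simp add: e_def)
  next
    case (Suc m)
    have "e m = Q (e m) * G + R (e m) + ?p * e (Suc m)" using QRE(1)[OF e, of m] by (simp add: e_def)
    from arg_cong[OF this, of "\<lambda>x. ?p ^ m * x"] Suc show ?case by (simp add: algebra_simps)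
  qed
  obtain q where q: "restricted q" "\<And>m. ?p ^ m dvd (\<Sum>k<m. ?p ^ k * Q (e k)) - q"
    using restricted_power_series_in_residue_char[of "\<lambda>k. Q (e k)"] QRE(2)[OF e] by blast
  obtain r where r: "restricted r" "\<And>m. ?p ^ m dvd (\<Sum>k<m. ?p ^ k * R (e k)) - r"
    using restricted_power_series_in_residue_char[of "\<lambda>k. R (e k)"] QRE(4)[OF e] by blast
  have "f - (q * G + r) = 0"
  proof (rule fps_padic_eq_0I)
    fix m
    have "f - (q * G + r) = ((\<Sum>k<m. ?p ^ k * Q (e k)) - q) * G + ((\<Sum>k<m. ?p ^ k * R (e k)) - r)
        + ?p ^ m * e m"
      by (subst (1) partial[of m]) (simp add: algebra_simps)
    also have "?p ^ m dvd \<dots>" using q(2)[of m] r(2)[of m] by (intro dvd_add) simp_all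
    finally show "?p ^ m dvd f - (q * G + r)" .
  qed
  moreover have "fps_nth r n = 0" if "n \<ge> d" for n
  proof (rule padic_int_eq_0I)
    fix m
    have "fps_nth (?p ^ k * R (e k)) n = 0" for k
      using QRE(3)[OF e that, of k] by (simp add: fps_nth_residue_char_power_mult)
    then have "residue_char ^ m dvd 0 - fps_nth r n"
      using r(2)[of m, unfolded fps_residue_char_power_dvd_iff, rule_format, of n]
      by (simp add: fps_sum_nth)
    then show "residue_char ^ m dvd fps_nth r n" by simp
  qed
  ultimately show thesis using that[of q r] q(1) by simp
qed

text \<open>Remove the largest power of p, leaving G of degree d modulo p, and divide t^d by G. The
  difference of t^d and the remainder is the monic W = q G. Comparing degrees modulo p shows that q
  is a unit, and V is its inverse.\<close>

lemma weierstrass_preparation_exists: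
  fixes F :: "'p::prime_card padic_int fps"
  assumes "restricted F" "F \<noteq> 0"
  shows "\<exists>s W V. weierstrass_preparation F s W V"
proof -
  let ?p = "of_nat CARD('p) :: 'p padic_int fps"
  \<comment> \<open>Minimality is stated for \<open>Suc s\<close> so that the predecessor of the
    least s yields divisibility by p^s; for s = 0 this is trivial.\<close>
  define s where "s = (LEAST s. \<not> ?p ^ Suc s dvd F)"
  have "\<exists>s. \<not> ?p ^ Suc s dvd F"
  proof (rule ccontr)
    assume "\<nexists>s. \<not> ?p ^ Suc s dvd F"
    then have "?p ^ m dvd F" for m by (cases m) auto
    then have "F = 0" by (rule fps_padic_eq_0I)
    with assms(2) show False by simp
  qed
  then have s: "\<not> ?p ^ Suc s dvd F" unfolding s_def by (rule LeastI_ex)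
  have "?p ^ s dvd F"
  proof (cases s)
    case (Suc s')
    then show ?thesis using not_less_Least[of s' "\<lambda>s. \<not> ?p ^ Suc s dvd F"] unfolding s_def by auto
  qed simp
  then obtain G where G: "F = ?p ^ s * G" by blast
  then have "restricted G" using assms(1) restricted_cancel_residue_char by blast
  moreover have "\<not> ?p dvd G" using s unfolding G power_Suc2 by (metis dvd_refl mult_dvd_mono)
  ultimately obtain d where d: "\<not> residue_char dvd fps_nth G d"
    "\<And>n. n > d \<Longrightarrow> residue_char dvd fps_nth G n"
    using restricted_reduced_degree by blast
  obtain q r where qr: "fps_of_poly (monom 1 d) = q * G + r" "restricted q"
    "\<And>n. n \<ge> d \<Longrightarrow> fps_nth r n = 0"
    using weierstrass_division[OF restricted_fps_of_poly \<open>restricted G\<close> d] by blast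
  define W where "W = monom 1 d - (\<Sum>i<d. monom (fps_nth r i) i)"
  have coeff_W: "coeff W n = (if n = d then 1 else 0) - fps_nth r n" for n
    using qr(3)[of n] by (auto simp: W_def coeff_sum_monom)
  then have W: "fps_of_poly W = q * G"
  proof (intro fps_ext)
    fix n
    show "fps_nth (fps_of_poly W) n = fps_nth (q * G) n"
      using arg_cong[OF qr(1), of "\<lambda>F. fps_nth F n"]
      by (simp add: coeff_W eq_diff_eq[symmetric] split: if_splits)
  qed
  have "degree W \<le> d" using coeff_W qr(3) by (intro degree_le) auto
  moreover have Wd: "coeff W d = 1" using coeff_W qr(3)[of d] by simp
  ultimately have lead: "lead_coeff W = 1" "degree W = d"
    using le_degree[of W d] by simp_all
  have one: "\<not> residue_char dvd (1 :: 'p padic_int)" by (simp flip: reduce_eq_0_iff)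
  have "\<not> ?p dvd q"
  proof
    assume "?p dvd q"
    then have "?p dvd fps_of_poly W" unfolding W by (rule dvd_mult2)
    then show False using one Wd unfolding fps_residue_char_dvd_iff by (metis fps_of_poly_nth)
  qed
  then obtain m where m: "\<not> residue_char dvd fps_nth q m"
    "\<And>n. n > m \<Longrightarrow> residue_char dvd fps_nth q n"
    using restricted_reduced_degree[OF qr(2)] by blast
  have "\<not> residue_char dvd fps_nth (q * G) (m + d)"
    using m d by (rule residue_char_not_dvd_mult_nth)
  \<comment> \<open>Modulo p the degrees of q and G add up to m + d, but W = q G has degree d; hence
    m = 0.\<close>
  then have "m + d \<le> d" using lead(2) unfolding W[symmetric]
    by (metis coeff_eq_0 dvd_0_right fps_of_poly_nth not_le_imp_less)
  then have "restricted_unit q" using m qr(2) by (simp add: restricted_unit_iff)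
  then obtain V where V: "restricted V" "q * V = 1" unfolding restricted_unit_def by blast
  have "G = fps_of_poly W * V" using V(2) by (simp add: W mult.assoc mult.left_commute[of q])
  moreover have "restricted_unit V"
    using V qr(2) unfolding restricted_unit_def by (metis mult.commute)
  ultimately have "weierstrass_preparation F s W V"
    using lead(1) unfolding weierstrass_preparation_def G
    by (simp flip: fps_const_power add: fps_of_nat mult.assoc)
  then show ?thesis by blast
qed

lemma weierstrass_preparation_nth:
  fixes F :: "'p::prime_card padic_int fps"
  assumes "weierstrass_preparation F s W V"
  shows "residue_char ^ s dvd fps_nth F n" "\<not> residue_char ^ Suc s dvd fps_nth F (degree W)"
proof -
  have F: "fps_nth F n = residue_char ^ s * fps_nth (fps_of_poly W * V) n" for n
    using assms unfolding weierstrass_preparation_def by (auto simp: mult.assoc simp flip: fps_of_nat)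
  then show "residue_char ^ s dvd fps_nth F n" by simp
  have one: "\<not> residue_char dvd (1 :: 'p padic_int)" by (simp flip: reduce_eq_0_iff)
  have W: "lead_coeff W = 1" and "restricted_unit V"
    using assms by (simp_all add: weierstrass_preparation_def)
  \<comment> \<open>The summand 0 is the degree of V modulo p.\<close>
  then have "\<not> residue_char dvd fps_nth (fps_of_poly W * V) (degree W + 0)"
    by (intro residue_char_not_dvd_mult_nth)
       (auto simp: restricted_unit_iff one coeff_eq_0)
  then show "\<not> residue_char ^ Suc s dvd fps_nth F (degree W)"
    unfolding F by (simp add: power_Suc2 mult.commute)
qed

section \<open>Values and zeros of restricted series\<close>

lemma sum_fps_nth_approx_poly:
  fixes F :: "'p::prime_card padic_int fps"
  assumes "of_nat CARD('p) ^ m dvd F - fps_of_poly g" "degree g < N"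
  shows "residue_char ^ m dvd (\<Sum>n<N. fps_nth F n * z ^ n) - poly g z"
proof -
  have "poly g z = (\<Sum>n<N. coeff g n * z ^ n)"
    unfolding poly_altdef using assms(2)
    by (intro sum.mono_neutral_left) (auto simp: coeff_eq_0)
  then have "(\<Sum>n<N. fps_nth F n * z ^ n) - poly g z = (\<Sum>n<N. fps_nth (F - fps_of_poly g) n * z ^ n)"
    by (simp add: left_diff_distrib sum_subtractf)
  moreover have "residue_char ^ m dvd (\<Sum>n<N. fps_nth (F - fps_of_poly g) n * z ^ n)"
    using assms(1) unfolding fps_residue_char_power_dvd_iff by (intro dvd_sum dvd_mult2) blast
  ultimately show ?thesis by simp
qed

text \<open>Values are computed modulo p^m on polynomials. This lets a product of series be
  evaluated without rearranging a double series.\<close>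

lemma adic_sums_approx_poly:
  fixes F :: "'p::prime_card padic_int fps"
  assumes "of_nat CARD('p) ^ m dvd F - fps_of_poly g"
    and "adic_sums residue_char (\<lambda>n. fps_nth F n * z ^ n) L"
  shows "residue_char ^ m dvd poly g z - L"
proof -
  obtain N0 where N0: "\<forall>N\<ge>N0. residue_char ^ m dvd (\<Sum>n<N. fps_nth F n * z ^ n) - L"
    using assms(2) unfolding adic_sums_def adic_tendsto_def eventually_sequentially by blast
  let ?S = "\<Sum>n<max N0 (Suc (degree g)). fps_nth F n * z ^ n"
  have "residue_char ^ m dvd ?S - L" "residue_char ^ m dvd ?S - poly g z"
    using N0 assms(1) by (auto intro: sum_fps_nth_approx_poly)
  from dvd_diff[OF this] show ?thesis by simp
qed

lemma adic_sums_approx_polyI: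
  fixes F :: "'p::prime_card padic_int fps"
  assumes "\<And>m. \<exists>g. of_nat CARD('p) ^ m dvd F - fps_of_poly g \<and> residue_char ^ m dvd poly g z - L"
  shows "adic_sums residue_char (\<lambda>n. fps_nth F n * z ^ n) L"
  unfolding adic_sums_def adic_tendsto_def eventually_sequentially
proof
  fix m
  obtain g where g: "of_nat CARD('p) ^ m dvd F - fps_of_poly g" "residue_char ^ m dvd poly g z - L"
    using assms by blast
  have "residue_char ^ m dvd (\<Sum>n<N. fps_nth F n * z ^ n) - L" if "N \<ge> Suc (degree g)" for N
    using dvd_add[OF sum_fps_nth_approx_poly[OF g(1), of N z] g(2)] that by simp
  then show "\<exists>N0. \<forall>N\<ge>N0. residue_char ^ m dvd (\<Sum>n<N. fps_nth F n * z ^ n) - L" by blast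
qed

text \<open>With V' inverse to V, p^s W = F V'. If polynomials g and h approximate F and V' modulo
  p^m, then p^s W(z) is congruent to g(z) h(z), and g(z) to F(z) = 0. This holds for all m, and p^s
  cancels in a domain.\<close>

lemma weierstrass_preparation_root:
  fixes F :: "'p::prime_card padic_int fps"
  assumes prep: "weierstrass_preparation F s W V" and "restricted F"
    and sums: "adic_sums residue_char (\<lambda>n. fps_nth F n * z ^ n) 0"
  shows "poly W z = 0"
proof -
  obtain V' where V': "restricted V'" "V * V' = 1"
    using prep unfolding weierstrass_preparation_def restricted_unit_def by blast
  define Wp where "Wp = smult (residue_char ^ s) W"
  have Wp: "fps_of_poly Wp = F * V'"
    using prep V'(2) unfolding weierstrass_preparation_def Wp_def
    by (simp add: fps_of_poly_smult mult.assoc)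
  have "poly Wp z = 0"
  proof (rule padic_int_eq_0I)
    fix m
    obtain g h where g: "of_nat CARD('p) ^ m dvd F - fps_of_poly g"
      and h: "of_nat CARD('p) ^ m dvd V' - fps_of_poly h"
      using \<open>restricted F\<close> V'(1) unfolding restricted_iff_approx_poly by metis
    from g h have "of_nat CARD('p) ^ m dvd (F - fps_of_poly g) * V' + fps_of_poly g * (V' - fps_of_poly h)"
      by (intro dvd_add) auto
    also have "\<dots> = fps_of_poly Wp - fps_of_poly (g * h)"
      by (simp add: fps_of_poly_mult Wp algebra_simps)
    finally have "of_nat CARD('p) ^ m dvd fps_of_poly Wp - fps_of_poly (g * h)" .
    moreover have "adic_sums residue_char (\<lambda>n. fps_nth (fps_of_poly Wp) n * z ^ n) (poly Wp z)"
      by (rule adic_sums_approx_polyI) (auto intro!: exI[of _ Wp])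
    ultimately have "residue_char ^ m dvd poly (g * h) z - poly Wp z"
      by (rule adic_sums_approx_poly)
    moreover have "residue_char ^ m dvd poly (g * h) z"
      using adic_sums_approx_poly[OF g sums] by simp
    ultimately show "residue_char ^ m dvd poly Wp z" by (simp add: dvd_diff_right_iff)
  qed
  moreover have "(residue_char :: 'p padic_int) ^ s \<noteq> 0" by simp
  ultimately show ?thesis by (simp add: Wp_def)
qed

text \<open>The zeros p^m accumulate at 0, so the lowest nonzero coefficient would be divisible by every p^m.\<close>

lemma restricted_expansion_unique:
  fixes F F' :: "'p::prime_card padic_int fps"
  assumes "restricted_expansion F f" "restricted_expansion F' f"
  shows "F = F'"
proof (rule ccontr)
  assume "F \<noteq> F'"
  define D where "D = F - F'"
  define n where "n = subdegree D"
  have D: "D \<noteq> 0" using \<open>F \<noteq> F'\<close> by (simp add: D_def)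
  have "fps_nth D n = 0"
  proof (rule padic_int_eq_0I)
    fix m
    \<comment> \<open>At t = p^m the terms above n are divisible by t^(n+1) = p^(m (n+1)). Working
      to that precision leaves p^(m (n+1)) dividing D_n p^(m n), hence p^m dividing D_n.\<close>
    let ?t = "residue_char ^ m :: 'p padic_int"
    have "\<forall>\<^sub>F N in sequentially. residue_char ^ (m * Suc n) dvd (\<Sum>i<N. fps_nth F i * ?t ^ i) - f ?t"
      "\<forall>\<^sub>F N in sequentially. residue_char ^ (m * Suc n) dvd (\<Sum>i<N. fps_nth F' i * ?t ^ i) - f ?t"
      using assms unfolding restricted_expansion_def adic_sums_def adic_tendsto_def by blast+
    then have "\<forall>\<^sub>F N in sequentially. residue_char ^ (m * Suc n) dvd (\<Sum>i<N. fps_nth F i * ?t ^ i) - f ?t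
        \<and> residue_char ^ (m * Suc n) dvd (\<Sum>i<N. fps_nth F' i * ?t ^ i) - f ?t \<and> N > n"
      by (intro eventually_conj eventually_gt_at_top)
    then obtain N where N: "residue_char ^ (m * Suc n) dvd (\<Sum>i<N. fps_nth F i * ?t ^ i) - f ?t"
      "residue_char ^ (m * Suc n) dvd (\<Sum>i<N. fps_nth F' i * ?t ^ i) - f ?t" "N > n"
      using eventually_happens'[OF sequentially_bot] by blast
    have "residue_char ^ (m * Suc n) dvd (\<Sum>i<N. fps_nth D i * ?t ^ i)"
      using dvd_diff[OF N(1,2)] by (simp add: D_def sum_subtractf algebra_simps)
    also have "(\<Sum>i<N. fps_nth D i * ?t ^ i)
        = fps_nth D n * ?t ^ n + (\<Sum>i\<in>{..<N}-{n}. fps_nth D i * ?t ^ i)"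
      using N(3) by (intro sum.remove) auto
    finally have "residue_char ^ (m * Suc n) dvd
        fps_nth D n * ?t ^ n + (\<Sum>i\<in>{..<N}-{n}. fps_nth D i * ?t ^ i)" .
    moreover have "residue_char ^ (m * Suc n) dvd (\<Sum>i\<in>{..<N}-{n}. fps_nth D i * ?t ^ i)"
    proof (rule dvd_sum)
      fix i assume "i \<in> {..<N} - {n}"
      then consider "i < n" | "i \<ge> Suc n" by force
      then show "residue_char ^ (m * Suc n) dvd fps_nth D i * ?t ^ i"
      proof cases
        case 1
        then show ?thesis by (simp add: n_def nth_less_subdegree_zero)
      next
        case 2
        then show ?thesis
          by (simp del: mult_Suc_right flip: power_mult add: le_imp_power_dvd dvd_mult mult_le_mono2)
      qed
    qed
    ultimately have "residue_char ^ (m * Suc n) dvd fps_nth D n * ?t ^ n"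
      by (simp add: dvd_add_left_iff)
    then show "residue_char ^ m dvd fps_nth D n" by (simp add: power_add flip: power_mult)
  qed
  with D show False by (simp add: n_def nth_subdegree_zero_iff)
qed

section \<open>Factorials and binomial coefficients in the p-adic integers\<close>

text \<open>Legendre's recursion: the multiples of p among the factors are p, 2p, ..., mp, which
  contribute p^m m!. The other factors are prime to p.\<close>

lemma fact_mult_prime_add:
  fixes p :: nat
  assumes "prime p"
  shows "c < p \<Longrightarrow> \<exists>u. \<not> p dvd u \<and> fact (p * m + c) = p ^ m * fact m * u"
proof (induction m arbitrary: c)
  have step: "\<exists>u. \<not> p dvd u \<and> fact (p * m + c) = p ^ m * fact m * u"
    if 0: "\<exists>u. \<not> p dvd u \<and> fact (p * m) = p ^ m * fact m * u" and "c < p" for m c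
    using \<open>c < p\<close>
  proof (induction c)
    case 0
    then show ?case using that by simp
  next
    case (Suc c)
    then obtain u where u: "\<not> p dvd u" "fact (p * m + c) = p ^ m * fact m * u" by auto
    have "\<not> p dvd Suc (p * m + c)"
      using Suc.prems by (metis add_Suc_right dvd_add_right_iff dvd_triv_left nat_dvd_not_less zero_less_Suc)
    with u assms have "\<not> p dvd Suc (p * m + c) * u" 
      by (simp only: prime_dvd_mult_iff) simp
    moreover have "fact (p * m + Suc c) = p ^ m * fact m * (Suc (p * m + c) * u)"
      using u(2) by (simp add: algebra_simps)
    ultimately show ?case by blast
  qed
  {
    case 0
    have "\<exists>u. \<not> p dvd u \<and> fact (p * 0) = p ^ 0 * fact 0 * u"
      using assms by (intro exI[of _ 1]) auto
    then show ?case using step 0 by blast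
  next
    case (Suc m)
    have p: "p > 0" using assms by (simp add: prime_gt_0_nat)
    then obtain u where u: "\<not> p dvd u" "fact (p * m + (p - 1)) = p ^ m * fact m * u"
      using Suc.IH[of "p - 1"] by auto
    have "p * Suc m = Suc (p * m + (p - 1))" using p by simp
    then have "fact (p * Suc m) = (p * Suc m) * fact (p * m + (p - 1))" by (metis fact_Suc of_nat_id)
    then have "fact (p * Suc m) = p ^ Suc m * fact (Suc m) * u" using u(2) by (simp add: algebra_simps)
    with u(1) show ?case using step Suc.prems by blast
  }
qed

text \<open>With m = k div p the exponent satisfies e(k) = m + e(m), and induction gives (p-1) e(k)
  \<le> m (p-1) + (m-1) = m p - 1 \<le> k - 1. For k = 0 truncated subtraction makes the bound say e
  = 0.\<close>

lemma fact_eq_prime_power_mult: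
  fixes p :: nat
  assumes "prime p"
  shows "\<exists>e u. \<not> p dvd u \<and> fact k = p ^ e * u \<and> e * (p - 1) \<le> k - 1"
proof (induction k rule: less_induct)
  case (less k)
  show ?case
  proof (cases "k < p")
    case True
    then show ?thesis using assms prime_dvd_fact_iff[OF assms, of k] by (intro exI[of _ 0] exI[of _ "fact k"]) simp
  next
    case False
    define m where "m = k div p"
    have p: "p \<ge> 2" using assms by (rule prime_ge_2_nat)
    have m: "m > 0" "m < k" using False p by (auto simp: m_def div_greater_zero_iff)
    obtain e u where e: "\<not> p dvd u" "fact m = p ^ e * u" "e * (p - 1) \<le> m - 1" using less m by blast
    have "k mod p < p" using p by simp
    then obtain u' where u': "\<not> p dvd u'" "fact (p * m + k mod p) = p ^ m * fact m * u'"
      using fact_mult_prime_add[OF assms] by blast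
    have "fact k = p ^ (m + e) * (u * u')"
      using u'(2) e(2) by (simp add: m_def power_add mult_ac)
    moreover have "\<not> p dvd u * u'" using e(1) u'(1) assms by (simp add: prime_dvd_mult_iff)
    moreover have "(m + e) * (p - 1) \<le> k - 1"
    proof -
      have "(m + e) * (p - 1) \<le> m * (p - 1) + (m - 1)" using e(3) by (simp add: add_mult_distrib)
      also have "\<dots> = m * p - 1" using m p by (cases p) auto
      also have "\<dots> \<le> k - 1" unfolding m_def by (intro diff_le_mono) simp
      finally show ?thesis .
    qed
    ultimately show ?thesis by blast
  qed
qed

text \<open>The valuation of \<open>q k\<close> is k - e with e = v(k!). The bound for n < p is the
  one that compares coefficients; the cruder bound 2 n \<le> k, from p - 1 \<ge> 2, has no ceiling
  and gives convergence.\<close>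

lemma residue_char_power_divided_by_fact:
  assumes "CARD('p::prime_card) \<ge> 3"
  obtains q :: "nat \<Rightarrow> 'p::prime_card padic_int"
  where "\<And>k. fact k * q k = residue_char ^ k"
    and "\<And>k n. n \<le> k \<Longrightarrow> n < CARD('p) \<Longrightarrow> residue_char ^ n dvd q k"
    and "\<And>k n. 2 * n \<le> k \<Longrightarrow> residue_char ^ n dvd q k"
proof -
  have "\<exists>q :: 'p padic_int. fact k * q = residue_char ^ k
    \<and> (\<forall>n. n \<le> k \<longrightarrow> n < CARD('p) \<longrightarrow> residue_char ^ n dvd q)
    \<and> (\<forall>n. 2 * n \<le> k \<longrightarrow> residue_char ^ n dvd q)" for k
  proof -
    define p where "p = CARD('p)"
    have "prime p" "p \<ge> 3" using assms prime_card[where 'a = 'p] by (simp_all add: p_def)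
    then obtain e u where e: "\<not> p dvd u" "fact k = p ^ e * u" "e * (p - 1) \<le> k - 1"
      using fact_eq_prime_power_mult by blast
    have "(of_nat u :: 'p mod_ring) \<noteq> 0" using e(1) by (auto simp: p_def dest: of_nat_0_mod_ring_dvd)
    then have "\<not> residue_char dvd (of_nat u :: 'p padic_int)" by (simp flip: reduce_eq_0_iff)
    then obtain w :: "'p padic_int" where w: "of_nat u * w = 1" by (rule padic_unitI)
    have e2: "2 * e \<le> k - 1"
      using e(3) \<open>p \<ge> 3\<close> mult_le_mono2[of 2 "p - 1" e] by linarith
    then have "e \<le> k" by linarith
    define q where "q = residue_char ^ (k - e) * w"
    have "fact k * q = of_nat (fact k) * q" by simp
    also have "\<dots> = residue_char ^ e * residue_char ^ (k - e) * (of_nat u * w)"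
      unfolding e(2) by (simp add: q_def p_def mult_ac)
    also have "\<dots> = residue_char ^ k" using w \<open>e \<le> k\<close> by (simp flip: power_add)
    finally have "fact k * q = residue_char ^ k" .
    moreover have "residue_char ^ n dvd q" if "n \<le> k - e" for n
      unfolding q_def using le_imp_power_dvd[OF that] by (rule dvd_mult2)
    moreover have "n \<le> k - e" if "n \<le> k" "n < p" for n
    proof (cases "k < p")
      case True
      then have "e * (p - 1) < p - 1" using e(3) \<open>p \<ge> 3\<close> by linarith
      then have "e = 0" by (cases e) simp_all
      with that show ?thesis by simp
    next
      case False
      show ?thesis
      proof (rule ccontr)
        assume "\<not> n \<le> k - e"
        \<comment> \<open>Multiplying by p - 1 brings in the bound on e. With s = p - 2 everything
          collapses to k s + 1 \<le> (s + 1) s, which contradicts k \<ge> p.\<close>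
        then have "k + 1 \<le> p - 1 + e" using that \<open>e \<le> k\<close> by linarith
        then have "(k + 1) * (p - 1) \<le> (p - 1) * (p - 1) + e * (p - 1)"
          by (metis add_mult_distrib mult_le_mono1)
        then have "(k + 1) * (p - 1) \<le> (p - 1) * (p - 1) + (k - 1)" using e(3) by linarith
        moreover obtain s where s: "p = Suc (Suc s)"
          using \<open>p \<ge> 3\<close> that[of "p - 2"] by simp
        ultimately have "k * s + 1 \<le> Suc s * s" using False by (simp add: algebra_simps)
        moreover have "Suc s * s \<le> k * s" using False by (intro mult_le_mono1) (simp add: s)
        ultimately show False by linarith
      qed
    qed
    moreover have "n \<le> k - e" if "2 * n \<le> k" for n using that e2 by linarith
    ultimately show ?thesis unfolding p_def by blast
  qed
  then show thesis using that by metis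
qed

lemma prod_of_nat_diff_eq_fact_mult_binomial:
  "(\<Prod>i<k. of_nat n - of_nat i) = (fact k * of_nat (n choose k) :: 'a::{comm_ring_1,semiring_char_0})"
proof -
  \<comment> \<open>The identity passes from the rationals to the integers by injectivity, and from
    there to the given ring.\<close>
  have "(of_int (\<Prod>i<k. int n - int i) :: rat) = of_int (fact k * int (n choose k))"
    using gbinomial_mult_fact[of k "of_nat n :: rat"]
    by (simp add: binomial_gbinomial atLeast0LessThan)
  then have "(\<Prod>i<k. int n - int i) = fact k * int (n choose k)" by (simp only: of_int_eq_iff)
  from arg_cong[OF this, of "of_int :: int \<Rightarrow> 'a"] show ?thesis by simp
qed

lemma dvd_prod_diff_prod:
  fixes f g :: "'i \<Rightarrow> 'a::comm_ring_1"
  assumes "\<And>i. i \<in> A \<Longrightarrow> q dvd f i - g i"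
  shows "q dvd prod f A - prod g A"
  using assms
proof (induction A rule: infinite_finite_induct)
  case (insert a A)
  then have "q dvd f a * (prod f A - prod g A) + (f a - g a) * prod g A"
    by (intro dvd_add) auto
  with insert.hyps show ?case by (simp add: algebra_simps)
qed auto

text \<open>This is the exactness of the division in \<open>padic_binomial\<close>. Modulo p^k, a
  multiple of k!, the number t may be replaced by a natural number n, for which the product is k!
  times an ordinary binomial coefficient.\<close>

lemma fact_mult_padic_binomial:
  fixes t :: "'p::prime_card padic_int"
  assumes "CARD('p) \<ge> 3"
  shows "fact k * padic_binomial t k = (\<Prod>i<k. t - of_nat i)"
proof -
  obtain q :: "nat \<Rightarrow> 'p padic_int" where "\<And>k. fact k * q k = residue_char ^ k"
    using residue_char_power_divided_by_fact[OF assms] by metis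
  then have fact_dvd: "(fact k :: 'p padic_int) dvd residue_char ^ k" by (metis dvd_triv_left)
  define n where "n = nat (Rep_padic_int t k)"
  have "0 \<le> Rep_padic_int t k"
    using Rep_padic_int_mod[of t k] prime_gt_0_int[OF prime_card_int[where 'a = 'p]]
    by (metis pos_mod_sign zero_less_power)
  then have "residue_char ^ k dvd t - of_nat n"
    unfolding residue_char_power_dvd_diff_iff Rep_padic_int_of_nat by (simp add: n_def)
  then have "residue_char ^ k dvd (\<Prod>i<k. t - of_nat i) - (\<Prod>i<k. of_nat n - of_nat i)"
    by (intro dvd_prod_diff_prod) simp
  then have "fact k dvd (\<Prod>i<k. t - of_nat i) - fact k * of_nat (n choose k)"
    unfolding prod_of_nat_diff_eq_fact_mult_binomial using fact_dvd by (rule dvd_trans[rotated])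
  then have "fact k dvd (\<Prod>i<k. t - of_nat i)" by (simp add: dvd_diff_left_iff)
  then show ?thesis unfolding padic_binomial_def by simp
qed

lemma residue_char_power_mult_padic_binomial:
  fixes t :: "'p::prime_card padic_int"
  assumes "CARD('p) \<ge> 3" "fact k * q = residue_char ^ k"
  shows "residue_char ^ k * padic_binomial t k = q * (\<Prod>i<k. t - of_nat i)"
  using fact_mult_padic_binomial[OF assms(1), of k t] assms(2) by (metis mult.assoc mult.commute)

section \<open>Trace and reduction modulo p\<close>

lemma is_algebra_module: "is_algebra scale \<Longrightarrow> Modules.module scale"
  by (simp add: is_algebra_def)

lemma is_algebra_scale_mult:
  assumes "is_algebra scale"
  shows "scale c x * y = scale c (x * y)" "x * scale c y = scale c (x * y)"
  using assms unfolding is_algebra_def by (metis, metis mult.commute)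

lemma is_algebra_scale_of_nat:
  fixes x :: "'a::comm_ring_1"
  assumes "is_algebra scale"
  shows "scale (of_nat n) x = of_nat n * x"
proof -
  interpret Modules.module scale using assms by (rule is_algebra_module)
  show ?thesis by (induction n) (simp_all add: scale_left_distrib distrib_right)
qed

lemma is_basis_representation:
  assumes "Modules.module scale" "is_basis scale B"
  shows is_basis_representation_add: "Modules.module.representation scale B (x + y) b =
      Modules.module.representation scale B x b + Modules.module.representation scale B y b"
    and is_basis_representation_diff: "Modules.module.representation scale B (x - y) b =
      Modules.module.representation scale B x b - Modules.module.representation scale B y b"
    and is_basis_representation_scale: "Modules.module.representation scale B (scale c x) b =
      c * Modules.module.representation scale B x b"
    and is_basis_sum_representation: "(\<Sum>b\<in>B. scale (Modules.module.representation scale B x b) b) = x"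
proof -
  interpret Modules.module scale by fact
  have B: "finite B" "independent B" "span B = UNIV" using assms(2) unfolding is_basis_def by auto
  show "representation B (x + y) b = representation B x b + representation B y b"
    "representation B (x - y) b = representation B x b - representation B y b"
    "representation B (scale c x) b = c * representation B x b"
    using B by (simp_all add: representation_add representation_diff representation_scale)
  show "(\<Sum>b\<in>B. scale (representation B x b) b) = x"
    by (rule sum_representation_eq) (use B in auto)
qed

lemma alg_trace_linear:
  assumes "is_algebra scale" "is_basis scale B0"
  shows alg_trace_add: "alg_trace scale (x + y) = alg_trace scale x + alg_trace scale y"
    and alg_trace_scale: "alg_trace scale (scale c x) = c * alg_trace scale x"
proof -
  define B where "B = (SOME B. is_basis scale B)"
  have "is_basis scale B" unfolding B_def using assms(2) by (rule someI)
  note rep = is_basis_representation[OF is_algebra_module[OF assms(1)] this]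
  show "alg_trace scale (x + y) = alg_trace scale x + alg_trace scale y"
    by (simp add: alg_trace_def Let_def flip: B_def) (simp add: distrib_right rep sum.distrib)
  show "alg_trace scale (scale c x) = c * alg_trace scale x"
    by (simp add: alg_trace_def Let_def flip: B_def)
       (simp add: is_algebra_scale_mult[OF assms(1)] rep sum_distrib_left)
qed

lemma alg_trace_zero:
  assumes "is_algebra scale" "is_basis scale B"
  shows "alg_trace scale 0 = 0"
  using alg_trace_add[OF assms, of 0 0] by simp

lemma alg_trace_diff:
  assumes "is_algebra scale" "is_basis scale B"
  shows "alg_trace scale (x - y) = alg_trace scale x - alg_trace scale y"
  using alg_trace_add[OF assms, of "x - y" y] by simp

lemma alg_trace_sum:
  assumes "is_algebra scale" "is_basis scale B"
  shows "alg_trace scale (\<Sum>i\<in>I. g i) = (\<Sum>i\<in>I. alg_trace scale (g i))"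
  by (induction I rule: infinite_finite_induct) (simp_all add: alg_trace_add[OF assms] alg_trace_zero[OF assms])

text \<open>
  The generators v i with linear coordinate functions D i need not be independent: this
  spares the proof that a basis of A reduces to a basis of A/pA.
\<close>

lemma alg_trace_eq_sum:
  assumes alg: "is_algebra scale" and "is_basis scale B0"
    and D_add: "\<And>i x y. i \<in> I \<Longrightarrow> D i (x + y) = D i x + D i y"
    and D_scale: "\<And>i c x. i \<in> I \<Longrightarrow> D i (scale c x) = c * D i x"
    and D_sum: "\<And>z. (\<Sum>i\<in>I. scale (D i z) (v i)) = z"
  shows "alg_trace scale x = (\<Sum>i\<in>I. D i (x * v i))"
proof -
  interpret Modules.module scale using alg by (rule is_algebra_module)
  define B where "B = (SOME B. is_basis scale B)"
  have "is_basis scale B" unfolding B_def using assms(2) by (rule someI)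
  note rep = is_basis_representation[OF is_algebra_module[OF assms(1)] this]
  have D_zero: "D i 0 = 0" if "i \<in> I" for i using D_add[OF that, of 0 0] by simp
  have D_sum': "D i (\<Sum>b\<in>B. g b) = (\<Sum>b\<in>B. D i (g b))" if "i \<in> I" for i and g
    using that by (induction B rule: infinite_finite_induct) (simp_all add: D_add D_zero)
  have rep_zero: "representation B 0 b = 0" for b using rep(1)[of 0 0 b] by simp
  have rep_sum: "representation B (\<Sum>i\<in>I. g i) b = (\<Sum>i\<in>I. representation B (g i) b)" for g b
    by (induction I rule: infinite_finite_induct) (simp_all add: rep rep_zero)
  have "alg_trace scale x = (\<Sum>b\<in>B. representation B (x * b) b)"
    by (simp add: alg_trace_def Let_def flip: B_def)
  \<comment> \<open>The computation is tr (S T) = tr (T S) for rectangular matrices: expand b in the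
    generators, exchange the sums, and reassemble x * v i from its coordinates in B.\<close>
  also have "\<dots> = (\<Sum>b\<in>B. representation B (x * (\<Sum>i\<in>I. scale (D i b) (v i))) b)"
    by (simp add: D_sum)
  also have "\<dots> = (\<Sum>b\<in>B. \<Sum>i\<in>I. D i b * representation B (x * v i) b)"
    by (simp add: sum_distrib_left is_algebra_scale_mult[OF alg] rep_sum rep)
  also have "\<dots> = (\<Sum>i\<in>I. \<Sum>b\<in>B. representation B (x * v i) b * D i b)"
    by (subst sum.swap) (simp add: mult.commute)
  also have "\<dots> = (\<Sum>i\<in>I. D i (\<Sum>b\<in>B. scale (representation B (x * v i) b) b))"
    by (intro sum.cong) (simp_all add: D_sum' D_scale)
  also have "\<dots> = (\<Sum>i\<in>I. D i (x * v i))" by (simp add: rep)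
  finally show ?thesis .
qed

section \<open>The quotient A/pA as an algebra over the field with p elements\<close>

lemma modp_add: "modp (x + y) = modp x + modp y"
  by (simp add: plus_modp.abs_eq)

lemma modp_mult: "modp (x * y) = modp x * modp y"
  by (simp add: times_modp.abs_eq)

lemma modp_power: "modp (x ^ n) = modp x ^ n"
  by (induction n) (simp_all add: modp_mult one_modp.abs_eq)

lemma modp_sum: "modp (\<Sum>i\<in>I. g i) = (\<Sum>i\<in>I. modp (g i))"
  by (induction I rule: infinite_finite_induct) (simp_all add: modp_add zero_modp.abs_eq)

lemma modp_eq_iff: "(modp x :: ('a::comm_ring_1, 'p::prime_card) modp) = modp y \<longleftrightarrow> of_nat CARD('p) dvd x - y"
  unfolding modp.abs_eq_iff cong_p_def ..

lemma modp_surj: "\<exists>z. X = modp z"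
  using Quotient3_abs_rep[OF Quotient3_modp, of X] by metis

lemma modp_scale_of_int:
  "modp_scale (of_int k) (modp x :: ('a::comm_ring_1, 'p::prime_card) modp) = modp (of_int k * x)"
proof -
  have "to_int_mod_ring (of_int k :: 'p mod_ring) = k mod int CARD('p)"
    unfolding of_int_of_int_mod_ring by transfer simp
  also have "k mod int CARD('p) - k = int CARD('p) * (- (k div int CARD('p)))"
    using mult_div_mod_eq[of "int CARD('p)" k] by (simp add: algebra_simps)
  finally have "of_int (to_int_mod_ring (of_int k :: 'p mod_ring)) * x - of_int k * x
      = of_nat CARD('p) * (of_int (- (k div int CARD('p))) * x)"
    by (simp only: left_diff_distrib[symmetric] of_int_diff[symmetric] of_int_mult of_int_of_nat_eq mult.assoc)
  then show ?thesis by (simp add: modp_scale.abs_eq modp_eq_iff)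
qed

lemma mod_ring_of_int_surj: "\<exists>k. (c :: 'p::prime_card mod_ring) = of_int k"
  by (metis of_int_mod_ring_to_int_mod_ring of_int_of_int_mod_ring)

lemma is_algebra_modp_scale:
  "is_algebra (modp_scale :: 'p::prime_card mod_ring \<Rightarrow> ('a::comm_ring_1, 'p) modp \<Rightarrow> _)"
  unfolding is_algebra_def
proof (intro conjI allI)
  show "Modules.module (modp_scale :: 'p mod_ring \<Rightarrow> ('a, 'p) modp \<Rightarrow> _)"
  proof
    fix a b :: "'p mod_ring" and x y :: "('a, 'p) modp"
    obtain i j where ij: "a = of_int i" "b = of_int j" using mod_ring_of_int_surj by metis
    obtain u v where uv: "x = modp u" "y = modp v" using modp_surj by metis
    show "modp_scale a (x + y) = modp_scale a x + modp_scale a y"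
      by (simp add: ij uv modp_scale_of_int distrib_left flip: modp_add)
    show "modp_scale (a + b) x = modp_scale a x + modp_scale b x"
      by (simp add: ij uv modp_scale_of_int flip: of_int_add) (simp add: distrib_right modp_add)
    show "modp_scale a (modp_scale b x) = modp_scale (a * b) x"
      by (simp add: ij uv modp_scale_of_int flip: of_int_mult)
         (simp add: mult.assoc)
    show "modp_scale 1 x = x"
      using modp_scale_of_int[of 1 u, where 'p = 'p] by (simp add: uv)
  qed
  fix c :: "'p mod_ring" and x y :: "('a, 'p) modp"
  obtain i where i: "c = of_int i" using mod_ring_of_int_surj by metis
  obtain u v where uv: "x = modp u" "y = modp v" using modp_surj by metis
  show "modp_scale c (x * y) = modp_scale c x * y"
    by (simp add: i uv modp_scale_of_int mult.assoc flip: modp_mult)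
qed

lemma vector_space_modp_scale:
  "vector_space (modp_scale :: 'p::prime_card mod_ring \<Rightarrow> ('a::comm_ring_1, 'p) modp \<Rightarrow> _)"
  using is_algebra_module[OF is_algebra_modp_scale]
  unfolding vector_space_def Modules.module_def .

lemma residue_char_dvd_diff_lift:
  fixes c :: "'p::prime_card padic_int"
  shows "residue_char dvd c - of_int (Rep_padic_int c 1)"
  by (simp add: reduce_eq_0_iff[symmetric]) (simp add: reduce_def)

text \<open>The scalar c differs from an integer by a multiple of p, and integers act in the same
  way on A and on A/pA.\<close>

lemma modp_scale_reduce:
  fixes scale :: "'p::prime_card padic_int \<Rightarrow> 'a::comm_ring_1 \<Rightarrow> 'a"
  assumes "is_algebra scale"
  shows "(modp (scale c x) :: ('a, 'p) modp) = modp_scale (reduce c) (modp x)"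
proof -
  interpret Modules.module scale using assms by (rule is_algebra_module)
  let ?k = "Rep_padic_int c 1"
  obtain d where d: "c - of_int ?k = residue_char * d" using residue_char_dvd_diff_lift[of c] by blast
  have "0 \<le> ?k"
    using Rep_padic_int_mod[of c 1] prime_gt_0_int[OF prime_card_int[where 'a = 'p]]
    by (metis pos_mod_sign zero_less_power)
  then have "scale (of_int ?k) x = of_int ?k * x"
    using is_algebra_scale_of_nat[OF assms, of "nat ?k" x] by simp
  moreover have "scale (c - of_int ?k) x = of_nat CARD('p) * scale d x"
    unfolding d using is_algebra_scale_of_nat[OF assms, of "CARD('p)" "scale d x"] by simp
  ultimately have "scale c x - of_int ?k * x = of_nat CARD('p) * scale d x"
    by (simp add: scale_left_diff_distrib)
  then show ?thesis by (simp add: reduce_def modp_scale_of_int modp_eq_iff)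
qed

lemma is_algebra_scale_residue_char_power:
  fixes scale :: "'p::prime_card padic_int \<Rightarrow> 'a::comm_ring_1 \<Rightarrow> 'a"
  assumes "is_algebra scale"
  shows "of_nat CARD('p) ^ m * x = scale (residue_char ^ m) x"
  using is_algebra_scale_of_nat[OF assms, of "CARD('p) ^ m" x] by simp

lemma modp_finite_span:
  fixes scale :: "'p::prime_card padic_int \<Rightarrow> 'a::comm_ring_1 \<Rightarrow> 'a"
  assumes "is_algebra scale" "is_basis scale B"
  shows "Modules.module.span modp_scale (modp ` B) = (UNIV :: ('a, 'p) modp set)"
proof -
  interpret vector_space "modp_scale :: 'p mod_ring \<Rightarrow> ('a, 'p) modp \<Rightarrow> _"
    by (rule vector_space_modp_scale)
  have "X \<in> span (modp ` B)" for X :: "('a, 'p) modp"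
  proof -
    obtain z where z: "X = modp z" using modp_surj by blast
    have "X = (\<Sum>b\<in>B. modp_scale (reduce (Modules.module.representation scale B z b)) (modp b))"
      using is_basis_sum_representation[OF is_algebra_module[OF assms(1)] assms(2), of z]
      by (simp add: z modp_sum[symmetric] modp_scale_reduce[OF assms(1), symmetric])
    then show ?thesis by (simp add: span_sum span_scale span_base)
  qed
  then show ?thesis by blast
qed

text \<open>\<open>alg_trace\<close> selects a basis, so its linearity on A/pA requires that one
  exists. Over a field it can be extracted from the images of a basis of A.\<close>

lemma modp_is_basis_exists:
  fixes scale :: "'p::prime_card padic_int \<Rightarrow> 'a::comm_ring_1 \<Rightarrow> 'a"
  assumes "is_algebra scale" "is_basis scale B"
  shows "\<exists>C. is_basis (modp_scale :: 'p mod_ring \<Rightarrow> ('a, 'p) modp \<Rightarrow> _) C"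
proof -
  interpret vector_space "modp_scale :: 'p mod_ring \<Rightarrow> ('a, 'p) modp \<Rightarrow> _"
    by (rule vector_space_modp_scale)
  obtain C where C: "C \<subseteq> modp ` B" "independent C" "modp ` B \<subseteq> span C"
    using maximal_independent_subset[of "modp ` B"] by blast
  have "finite C" using C(1) assms(2) by (meson finite_imageI finite_subset is_basis_def)
  moreover have "span C = UNIV"
    using span_minimal[OF C(3) subspace_span] modp_finite_span[OF assms] by auto
  ultimately show ?thesis using C(2) unfolding is_basis_def by blast
qed

text \<open>The coordinates on A, reduced modulo p, descend to functions \<open>D b\<close> on A/pA
  that recover every element from the images of B. The generators are indexed by B itself, so
  coincidences among the images do no harm.\<close>

lemma alg_trace_modp:
  fixes scale :: "'p::prime_card padic_int \<Rightarrow> 'a::comm_ring_1 \<Rightarrow> 'a"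
  assumes alg: "is_algebra scale" and basis: "is_basis scale B0"
  shows "alg_trace modp_scale (modp z :: ('a, 'p) modp) = reduce (alg_trace scale z)"
proof -
  define B where "B = (SOME B. is_basis scale B)"
  have B: "is_basis scale B" unfolding B_def using basis by (rule someI)
  note rep = is_basis_representation[OF is_algebra_module[OF alg] B]
  let ?R = "Modules.module.representation scale B"
  define D where "D b X = reduce (?R (rep_modp X) b)" for b and X :: "('a, 'p) modp"
  have D: "D b (modp z) = reduce (?R z b)" for b z
  proof -
    have "modp (rep_modp (modp z :: ('a, 'p) modp)) = (modp z :: ('a, 'p) modp)"
      using Quotient3_modp by (rule Quotient3_abs_rep)
    then obtain w where w: "rep_modp (modp z :: ('a, 'p) modp) - z = of_nat CARD('p) * w"
      unfolding modp_eq_iff by blast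
    then have "?R (rep_modp (modp z :: ('a, 'p) modp)) b - ?R z b = residue_char * ?R w b"
      unfolding rep(2)[symmetric]
      using is_algebra_scale_residue_char_power[OF alg, of 1 w] by (simp add: rep)
    then have "reduce (?R (rep_modp (modp z :: ('a, 'p) modp)) b - ?R z b) = 0"
      by simp
    then show ?thesis by (simp add: D_def)
  qed
  obtain C where C: "is_basis (modp_scale :: 'p mod_ring \<Rightarrow> ('a, 'p) modp \<Rightarrow> _) C"
    using modp_is_basis_exists[OF alg basis] by blast
  have "alg_trace modp_scale (modp z :: ('a, 'p) modp) = (\<Sum>b\<in>B. D b (modp z * modp b))"
  proof (rule alg_trace_eq_sum[OF is_algebra_modp_scale C])
    fix b and X Y :: "('a, 'p) modp" and c :: "'p mod_ring"
    obtain x y where xy: "X = modp x" "Y = modp y" using modp_surj by metis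
    obtain d where d: "c = reduce d" using reduce_lift by metis
    show "D b (X + Y) = D b X + D b Y" by (simp add: xy D rep flip: modp_add)
    show "D b (modp_scale c X) = c * D b X"
      by (simp add: xy d D rep flip: modp_scale_reduce[OF alg])
  next
    fix X :: "('a, 'p) modp"
    obtain x where x: "X = modp x" using modp_surj by metis
    show "(\<Sum>b\<in>B. modp_scale (D b X) (modp b)) = X"
      by (simp add: x D rep flip: modp_scale_reduce[OF alg] modp_sum)
  qed
  also have "\<dots> = reduce (\<Sum>b\<in>B. ?R (z * b) b)"
    by (simp add: D reduce_sum flip: modp_mult)
  also have "\<dots> = reduce (alg_trace scale z)"
    by (simp add: alg_trace_def Let_def flip: B_def)
  finally show ?thesis .
qed

section \<open>Subalgebras generated by one element\<close>

text \<open>Let m be the first exponent for which w^m lies in the span of the lower powers; it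
  exists because T is finite. Those lower powers are independent, and their span is stable under
  multiplication by w. It therefore contains all powers, and m is the dimension.\<close>

lemma adjoin_span_powers:
  fixes scale :: "'k::field \<Rightarrow> 'b::{comm_ring, comm_monoid_mult} \<Rightarrow> 'b"
  assumes "vector_space scale" and alg: "is_algebra scale"
    and T: "finite T" "Modules.module.span scale T = UNIV"
  shows "adjoin scale w \<subseteq> Modules.module.span scale ((\<lambda>i. w ^ i) ` {..<vector_space.dim scale (adjoin scale w)})"
proof -
  interpret vector_space scale by fact
  let ?S = "\<lambda>m. (\<lambda>i. w ^ i) ` {..<m::nat}"
  have ind: "independent (?S m) \<and> card (?S m) = m" if "\<And>k. k < m \<Longrightarrow> w ^ k \<notin> span (?S k)" for m
    using that
  proof (induction m)
    case (Suc m)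
    then have IH: "independent (?S m)" "card (?S m) = m" and notin: "w ^ m \<notin> span (?S m)"
      by simp_all
    have "w ^ m \<notin> ?S m" using notin span_base by (rule contrapos_nn)
    then have "card (insert (w ^ m) (?S m)) = Suc m" using IH(2) by simp
    moreover have "independent (insert (w ^ m) (?S m))" using notin IH(1) by (rule independent_insertI)
    moreover have "?S (Suc m) = insert (w ^ m) (?S m)" by (simp add: lessThan_Suc)
    ultimately show ?case by (simp only: simp_thms)
  qed (simp add: independent_empty)
  have "\<exists>m. w ^ m \<in> span (?S m)"
  proof (rule ccontr)
    assume "\<nexists>m. w ^ m \<in> span (?S m)"
    then have "independent (?S (Suc (card T)))" "card (?S (Suc (card T))) = Suc (card T)"
      using ind[of "Suc (card T)"] by blast+
    then show False using independent_span_bound[OF T(1), of "?S (Suc (card T))"] T(2) by simp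
  qed
  define m where "m = (LEAST m. w ^ m \<in> span (?S m))"
  have m: "w ^ m \<in> span (?S m)"
    unfolding m_def by (rule LeastI_ex) fact
  have S: "independent (?S m)" "card (?S m) = m"
    using ind[of m] not_less_Least[of _ "\<lambda>m. w ^ m \<in> span (?S m)"] unfolding m_def[symmetric] by blast+
  have powers: "w ^ i \<in> span (?S m)" for i
  proof (induction i)
    case 0
    \<comment> \<open>For m = 0 the choice of m itself says that w^0 lies in the span of the empty
      set.\<close>
    show ?case
    proof (cases "m = 0")
      case True
      then show ?thesis using m by simp
    next
      case False
      then have "w ^ 0 \<in> ?S m" by blast
      then show ?thesis by (rule span_base)
    qed
  next
    case (Suc i)
    have "subspace {x. w * x \<in> span (?S m)}"
      unfolding subspace_def
      by (auto simp: span_zero distrib_left is_algebra_scale_mult[OF alg] intro: span_add span_scale)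
    moreover have "w * x \<in> span (?S m)" if "x \<in> ?S m" for x
    proof -
      from that obtain k where k: "k < m" "x = w ^ k" by auto
      show ?thesis
      proof (cases "Suc k = m")
        case True
        then show ?thesis using m k by (metis power_Suc)
      next
        case False
        then have "w ^ Suc k \<in> ?S m" using k by (intro imageI) simp
        then show ?thesis using k by (simp add: span_base)
      qed
    qed
    ultimately have "w * w ^ i \<in> span (?S m)"
      using span_minimal[of "?S m" "{x. w * x \<in> span (?S m)}"] Suc by auto
    then show ?case by simp
  qed
  have sub: "adjoin scale w \<subseteq> span (?S m)"
    unfolding adjoin_def by (auto intro!: span_sum span_scale powers)
  have "?S m \<subseteq> adjoin scale w"
  proof
    fix x assume "x \<in> ?S m"
    then obtain k where k: "x = w ^ k" by blast
    have *: "(\<Sum>i\<le>degree (monom (1::'k) k). scale (coeff (monom 1 k) i) (w ^ i)) = w ^ k"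
      by (simp add: degree_monom_eq if_distrib[of "\<lambda>c. scale c _"] if_distribR cong: if_cong)
    show "x \<in> adjoin scale w"
      unfolding adjoin_def k by (rule range_eqI[where x = "monom 1 k"]) (rule *[symmetric])
  qed
  then have "dim (adjoin scale w) = m" using sub S by (intro dim_unique[of "?S m"])
  with sub show ?thesis by simp
qed

text \<open>Vanishing of the trace of x e is a linear condition on e, so it can be tested on the
  spanning powers of w.\<close>

lemma alg_trace_adjoin_nonzero:
  fixes scale :: "'k::field \<Rightarrow> 'b::{comm_ring, comm_monoid_mult} \<Rightarrow> 'b"
  assumes vs: "vector_space scale" and alg: "is_algebra scale" and basis: "is_basis scale B"
    and x: "x \<notin> trace_perp scale (adjoin scale w)"
  obtains j where "j < vector_space.dim scale (adjoin scale w)" "alg_trace scale (x * w ^ j) \<noteq> 0"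
proof -
  interpret vector_space scale by fact
  let ?S = "(\<lambda>i. w ^ i) ` {..<dim (adjoin scale w)}"
  have "\<exists>j<dim (adjoin scale w). alg_trace scale (x * w ^ j) \<noteq> 0"
  proof (rule ccontr)
    assume "\<not> ?thesis"
    then have "?S \<subseteq> {e. alg_trace scale (x * e) = 0}" by auto
    moreover have "subspace {e. alg_trace scale (x * e) = 0}"
      unfolding subspace_def
      by (auto simp: distrib_left is_algebra_scale_mult[OF alg] alg_trace_zero[OF alg basis]
          alg_trace_add[OF alg basis] alg_trace_scale[OF alg basis])
    ultimately have "span ?S \<subseteq> {e. alg_trace scale (x * e) = 0}" by (rule span_minimal)
    moreover have "adjoin scale w \<subseteq> span ?S"
      using basis unfolding is_basis_def by (intro adjoin_span_powers[OF vs alg]) auto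
    ultimately show False using x unfolding trace_perp_def by blast
  qed
  then show thesis using that by blast
qed

section \<open>Completeness of finite free algebras\<close>

lemma adic_separated:
  fixes scale :: "'p::prime_card padic_int \<Rightarrow> 'a::comm_ring_1 \<Rightarrow> 'a" and x :: 'a
  assumes alg: "is_algebra scale" and basis: "is_basis scale B"
    and x: "\<And>m. of_nat CARD('p) ^ m dvd x"
  shows "x = 0"
proof -
  interpret Modules.module scale using alg by (rule is_algebra_module)
  note rep = is_basis_representation[OF is_algebra_module[OF alg] basis]
  have "representation B x b = 0" for b
  proof (rule padic_int_eq_0I)
    fix m
    obtain w where "x = of_nat CARD('p) ^ m * w" using x[of m] by blast
    then show "residue_char ^ m dvd representation B x b"
      by (simp add: is_algebra_scale_residue_char_power[OF alg] rep)
  qed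
  with rep(4)[of x] show ?thesis by simp
qed

text \<open>Divisibility by p^m can be tested on coordinates, so limits are formed in each
  coordinate with the same modulus.\<close>

lemma adic_complete:
  fixes scale :: "'p::prime_card padic_int \<Rightarrow> 'a::comm_ring_1 \<Rightarrow> 'a" and X :: "nat \<Rightarrow> 'a"
  assumes alg: "is_algebra scale" and basis: "is_basis scale B"
    and X: "\<And>m N. N \<ge> N0 m \<Longrightarrow> of_nat CARD('p) ^ m dvd X (Suc N) - X N"
  obtains L where "\<And>m N. N \<ge> N0 m \<Longrightarrow> of_nat CARD('p) ^ m dvd X N - L"
proof -
  interpret Modules.module scale using alg by (rule is_algebra_module)
  note rep = is_basis_representation[OF is_algebra_module[OF alg] basis]
  have "\<exists>l. \<forall>m N. N \<ge> N0 m \<longrightarrow> residue_char ^ m dvd representation B (X N) b - l" for b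
  proof -
    have "residue_char ^ m dvd representation B (X (Suc N)) b - representation B (X N) b"
      if N: "N \<ge> N0 m" for m N
    proof -
      obtain w where "X (Suc N) - X N = of_nat CARD('p) ^ m * w" using X[OF N] by blast
      then show ?thesis
        unfolding rep(2)[symmetric] by (simp add: is_algebra_scale_residue_char_power[OF alg] rep)
    qed
    then show ?thesis using padic_int_complete[of N0 "\<lambda>N. representation B (X N) b"] by metis
  qed
  then obtain l where l: "\<And>b m N. N \<ge> N0 m \<Longrightarrow> residue_char ^ m dvd representation B (X N) b - l b"
    by metis
  show thesis
  proof (rule that)
    fix m N assume N: "N \<ge> N0 m"
    have "X N - (\<Sum>b\<in>B. scale (l b) b) = (\<Sum>b\<in>B. scale (representation B (X N) b) b) - (\<Sum>b\<in>B. scale (l b) b)"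
      by (simp add: rep)
    also have "\<dots> = (\<Sum>b\<in>B. scale (representation B (X N) b - l b) b)"
      by (simp add: scale_left_diff_distrib sum_subtractf)
    also have "of_nat CARD('p) ^ m dvd \<dots>"
    proof (rule dvd_sum)
      fix b
      obtain c where c: "representation B (X N) b - l b = residue_char ^ m * c" using l[OF N] by blast
      have "scale (representation B (X N) b - l b) b = of_nat CARD('p) ^ m * scale c b"
        by (simp add: c is_algebra_scale_residue_char_power[OF alg])
      then show "of_nat CARD('p) ^ m dvd scale (representation B (X N) b - l b) b" by (rule dvdI)
    qed
    finally show "of_nat CARD('p) ^ m dvd X N - (\<Sum>b\<in>B. scale (l b) b)" .
  qed
qed

text \<open>The k-th term is divisible by p^k, so N \<ge> m terms suffice modulo p^m. The
  description in \<open>binomial_power\<close> is met by a limit from completeness, and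
  separatedness makes that limit unique.\<close>

lemma binomial_power_approx:
  fixes scale :: "'p::prime_card padic_int \<Rightarrow> 'a::comm_ring_1 \<Rightarrow> 'a"
  assumes alg: "is_algebra scale" and basis: "is_basis scale B"
    and u: "u = 1 + of_nat CARD('p) * U" and "m \<le> N"
  shows "of_nat CARD('p) ^ m dvd
    (\<Sum>k<N. scale (padic_binomial t k * residue_char ^ k) (U ^ k)) - binomial_power scale u t"
proof -
  interpret Modules.module scale using alg by (rule is_algebra_module)
  define g where "g k = scale (padic_binomial t k) ((u - 1) ^ k)" for k
  have g: "g k = scale (padic_binomial t k * residue_char ^ k) (U ^ k)" for k
    by (simp add: g_def u power_mult_distrib is_algebra_scale_residue_char_power[OF alg])
  have "of_nat CARD('p) ^ m dvd (\<Sum>k<Suc N. g k) - (\<Sum>k<N. g k)" if "N \<ge> m" for m N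
  proof -
    have "g N = of_nat CARD('p) ^ N * scale (padic_binomial t N) (U ^ N)"
      unfolding g by (simp add: is_algebra_scale_residue_char_power[OF alg] mult.commute)
    then show ?thesis using le_imp_power_dvd[OF that, of "of_nat CARD('p) :: 'a"] by simp
  qed
  then obtain L where L: "\<And>m N. N \<ge> m \<Longrightarrow> of_nat CARD('p) ^ m dvd (\<Sum>k<N. g k) - L"
    using adic_complete[OF alg basis, of "\<lambda>m. m" "\<lambda>N. \<Sum>k<N. g k"] by blast
  have "binomial_power scale u t = L"
    unfolding binomial_power_def g_def[symmetric]
  proof (rule the_equality)
    show "adic_sums (of_nat CARD('p)) g L"
      unfolding adic_sums_def adic_tendsto_def eventually_sequentially using L by blast
  next
    fix L' assume L': "adic_sums (of_nat CARD('p)) g L'"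
    have "L' - L = 0"
    proof (rule adic_separated[OF alg basis])
      fix m
      obtain N where "\<forall>M\<ge>N. of_nat CARD('p) ^ m dvd (\<Sum>k<M. g k) - L'"
        using L' unfolding adic_sums_def adic_tendsto_def eventually_sequentially by blast
      then have *: "of_nat CARD('p) ^ m dvd (\<Sum>k<max m N. g k) - L'" by simp
      have "of_nat CARD('p) ^ m dvd ((\<Sum>k<max m N. g k) - L) - ((\<Sum>k<max m N. g k) - L')"
        by (rule dvd_diff[OF L *]) simp
      then show "of_nat CARD('p) ^ m dvd L' - L" by simp
    qed
    then show "L' = L" by simp
  qed
  with L[OF \<open>m \<le> N\<close>] show ?thesis by (simp add: g)
qed

section \<open>The trace of a binomial power\<close>

text \<open>The Newton basis as polynomials, so that Newton series can be rewritten in powers of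
  t.\<close>

definition falling_poly :: "nat \<Rightarrow> 'a::comm_ring_1 poly" where
  "falling_poly k = (\<Prod>i<k. [:- of_nat i, 1:])"

lemma poly_falling_poly: "poly (falling_poly k) t = (\<Prod>i<k. t - of_nat i)"
  by (simp add: falling_poly_def poly_prod)

lemma falling_poly_monic:
  "degree (falling_poly k :: 'a::idom poly) = k" "coeff (falling_poly k :: 'a::idom poly) k = 1"
proof -
  show "degree (falling_poly k :: 'a poly) = k"
    unfolding falling_poly_def by (subst degree_prod_eq_sum_degree) auto
  moreover have "lead_coeff (falling_poly k :: 'a poly) = 1"
    by (simp add: falling_poly_def lead_coeff_prod)
  ultimately show "coeff (falling_poly k :: 'a poly) k = 1" by simp
qed

text \<open>The factor p^k of (p U)^k absorbs the denominator of the binomial coefficient, leaving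
  \<open>q k\<close> times a falling factorial, which is a polynomial in t with p-adic integer
  coefficients.\<close>

lemma trace_binomial_power_approx:
  fixes scale :: "'p::prime_card padic_int \<Rightarrow> 'a::comm_ring_1 \<Rightarrow> 'a"
  assumes p3: "CARD('p) \<ge> 3" and alg: "is_algebra scale" and basis: "is_basis scale B"
    and u: "u = 1 + of_nat CARD('p) * U" and "m \<le> N"
    and q: "\<And>k. fact k * q k = residue_char ^ k"
  shows "residue_char ^ m dvd
    poly (\<Sum>k<N. smult (alg_trace scale (y * U ^ k) * q k) (falling_poly k)) t
      - alg_trace scale (y * binomial_power scale u t)"
proof -
  define S where "S = (\<Sum>k<N. scale (padic_binomial t k * residue_char ^ k) (U ^ k))"
  obtain w where "S - binomial_power scale u t = of_nat CARD('p) ^ m * w"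
    using binomial_power_approx[OF alg basis u \<open>m \<le> N\<close>, of t] unfolding S_def by blast
  then have "y * S - y * binomial_power scale u t = scale (residue_char ^ m) (y * w)"
    unfolding is_algebra_scale_residue_char_power[OF alg, symmetric]
    by (simp add: right_diff_distrib[symmetric] mult.left_commute)
  then have "alg_trace scale (y * S) - alg_trace scale (y * binomial_power scale u t)
      = residue_char ^ m * alg_trace scale (y * w)"
    by (simp flip: alg_trace_diff[OF alg basis] add: alg_trace_scale[OF alg basis])
  moreover have "alg_trace scale (y * S)
      = poly (\<Sum>k<N. smult (alg_trace scale (y * U ^ k) * q k) (falling_poly k)) t"
  proof -
    have "alg_trace scale (y * S)
        = (\<Sum>k<N. padic_binomial t k * residue_char ^ k * alg_trace scale (y * U ^ k))"
      unfolding S_def sum_distrib_left is_algebra_scale_mult[OF alg]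
        alg_trace_sum[OF alg basis] alg_trace_scale[OF alg basis] ..
    also have "\<dots> = (\<Sum>k<N. alg_trace scale (y * U ^ k) * q k * (\<Prod>i<k. t - of_nat i))"
    proof (intro sum.cong refl)
      fix k
      have "padic_binomial t k * residue_char ^ k = q k * (\<Prod>i<k. t - of_nat i)"
        using residue_char_power_mult_padic_binomial[OF p3 q] by (simp add: mult.commute)
      then show "padic_binomial t k * residue_char ^ k * alg_trace scale (y * U ^ k)
          = alg_trace scale (y * U ^ k) * q k * (\<Prod>i<k. t - of_nat i)"
        by (simp add: mult_ac)
    qed
    finally show ?thesis by (simp add: poly_sum poly_falling_poly)
  qed
  ultimately show ?thesis by simp
qed

text \<open>As \<open>falling_poly k\<close> has degree k, only k \<ge> n contribute to t^n. For t^j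
  the term k = j enters with leading coefficient 1, and the terms k > j are divisible by p^(j+1), so
  they cannot cancel it.\<close>

lemma trace_binomial_power_expansion:
  fixes scale :: "'p::prime_card padic_int \<Rightarrow> 'a::comm_ring_1 \<Rightarrow> 'a"
  assumes p3: "CARD('p) \<ge> 3" and alg: "is_algebra scale" and basis: "is_basis scale B"
    and u: "u = 1 + of_nat CARD('p) * U"
    and "r < CARD('p)" "j < r" and j: "\<not> residue_char dvd alg_trace scale (y * U ^ j)"
  obtains F where "restricted_expansion F (\<lambda>t. alg_trace scale (y * binomial_power scale u t))"
    and "\<not> residue_char ^ Suc j dvd fps_nth F j"
    and "\<And>n. n \<ge> r \<Longrightarrow> residue_char ^ r dvd fps_nth F n"
proof -
  obtain q :: "nat \<Rightarrow> 'p padic_int" where q: "\<And>k. fact k * q k = residue_char ^ k"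
    and q_small: "\<And>k n. n \<le> k \<Longrightarrow> n < CARD('p) \<Longrightarrow> residue_char ^ n dvd q k"
    and q_large: "\<And>k n. 2 * n \<le> k \<Longrightarrow> residue_char ^ n dvd q k"
    using residue_char_power_divided_by_fact[OF p3] by metis
  \<comment> \<open>\<open>c k\<close> is the Newton coefficient and already includes the factor
    \<open>q k\<close>.\<close>
  define c where "c k = alg_trace scale (y * U ^ k) * q k" for k
  define G where "G N = (\<Sum>k<N. smult (c k) (falling_poly k))" for N
  have "of_nat CARD('p) ^ m dvd fps_of_poly (G (Suc N)) - fps_of_poly (G N)" if "N \<ge> 2 * m" for m N
    using q_large[OF that] unfolding fps_residue_char_power_dvd_iff
    by (simp add: G_def c_def)
  then obtain F where F: "restricted F" and
    FG: "\<And>m N. N \<ge> 2 * m \<Longrightarrow> of_nat CARD('p) ^ m dvd fps_of_poly (G N) - F"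
    using restricted_complete[of "\<lambda>m. 2 * m" "\<lambda>N. fps_of_poly (G N)"] restricted_fps_of_poly by blast
  have "restricted_expansion F (\<lambda>t. alg_trace scale (y * binomial_power scale u t))"
    unfolding restricted_expansion_def
  proof (intro conjI allI F adic_sums_approx_polyI exI)
    fix t m
    show "of_nat CARD('p) ^ m dvd F - fps_of_poly (G (2 * m))"
      using FG[of m "2 * m"] dvd_minus_iff[of _ "fps_of_poly (G (2 * m)) - F"]
      by (simp only: minus_diff_eq)
    show "residue_char ^ m dvd poly (G (2 * m)) t - alg_trace scale (y * binomial_power scale u t)"
      unfolding G_def c_def by (rule trace_binomial_power_approx[OF p3 alg basis u _ q]) simp
  qed
  \<comment> \<open>The truncation at 2 r agrees with F modulo p^r. As j + 1 \<le> r, this precision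
    serves both remaining claims.\<close>
  moreover have Fr: "residue_char ^ r dvd fps_nth F n \<longleftrightarrow> residue_char ^ r dvd coeff (G (2 * r)) n" for n
    using FG[of r "2 * r"] unfolding fps_residue_char_power_dvd_iff
    by (metis dvd_diff_left_iff dvd_diff_right_iff fps_of_poly_nth fps_sub_nth order_refl)
  have coeff_G: "coeff (G N) n = (\<Sum>k<N. c k * coeff (falling_poly k) n)" for N n
    by (simp add: G_def coeff_sum)
  have "residue_char ^ r dvd fps_nth F n" if "n \<ge> r" for n
    unfolding Fr coeff_G
  proof (rule dvd_sum)
    fix k
    show "residue_char ^ r dvd c k * coeff (falling_poly k) n"
    proof (cases "k < n")
      case True
      then show ?thesis by (simp add: coeff_eq_0 falling_poly_monic)
    next
      case False
      then show ?thesis using q_small[of r k] that \<open>r < CARD('p)\<close> by (simp add: c_def)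
    qed
  qed
  moreover have "\<not> residue_char ^ Suc j dvd fps_nth F j"
  proof
    assume dvd: "residue_char ^ Suc j dvd fps_nth F j"
    have "residue_char ^ r dvd coeff (G (2 * r)) j - fps_nth F j"
      using FG[of r "2 * r"] unfolding fps_residue_char_power_dvd_iff by simp
    then have "residue_char ^ Suc j dvd coeff (G (2 * r)) j - fps_nth F j"
      using \<open>j < r\<close> by (meson Suc_leI dvd_trans le_imp_power_dvd)
    then have "residue_char ^ Suc j dvd coeff (G (2 * r)) j"
      using dvd by (simp only: dvd_diff_left_iff)
    also have "coeff (G (2 * r)) j = c j * coeff (falling_poly j) j
        + (\<Sum>k\<in>{..<2*r}-{j}. c k * coeff (falling_poly k) j)"
      unfolding coeff_G using \<open>j < r\<close> by (intro sum.remove) auto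
    finally have "residue_char ^ Suc j dvd c j * coeff (falling_poly j) j
        + (\<Sum>k\<in>{..<2*r}-{j}. c k * coeff (falling_poly k) j)" .
    moreover have "residue_char ^ Suc j dvd (\<Sum>k\<in>{..<2*r}-{j}. c k * coeff (falling_poly k) j)"
    proof (rule dvd_sum)
      fix k assume "k \<in> {..<2*r} - {j}"
      then consider "k < j" | "k \<ge> Suc j" by force
      then show "residue_char ^ Suc j dvd c k * coeff (falling_poly k) j"
      proof cases
        case 1
        then show ?thesis by (simp add: coeff_eq_0 falling_poly_monic)
      next
        case 2
        then have "residue_char ^ Suc j dvd q k"
          using \<open>j < r\<close> \<open>r < CARD('p)\<close> by (intro q_small) simp_all
        then show ?thesis unfolding c_def by (intro dvd_mult2 dvd_mult)
      qed
    qed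
    ultimately have "residue_char ^ Suc j dvd c j"
      by (simp add: dvd_add_left_iff falling_poly_monic del: power_Suc)
    \<comment> \<open>Multiplying by j! turns \<open>q j\<close> back into p^j, which then cancels
      against p^(j+1).\<close>
    then have "residue_char ^ Suc j dvd fact j * c j" by (rule dvd_mult)
    also have "fact j * c j = residue_char ^ j * alg_trace scale (y * U ^ j)"
      unfolding c_def q[symmetric] by (simp add: mult_ac)
    finally have "residue_char dvd alg_trace scale (y * U ^ j)"
      by (simp add: power_Suc2 del: power_Suc)
    with j show False by contradiction
  qed
  ultimately show thesis using that by blast
qed

section \<open>Comparison of valuations in the factorisation, and the count of zeros\<close>

theorem theorem3p15:
  fixes scale :: "'p::prime_card padic_int \<Rightarrow> 'a::comm_ring_1 \<Rightarrow> 'a"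
    and \<eta> \<gamma> U y :: 'a
    and a P r :: nat
    and \<omega> x :: "('a, 'p) modp"
    and E :: "('a, 'p) modp set"
    and f :: "'p padic_int \<Rightarrow> 'p padic_int"
  assumes "CARD('p) \<ge> 5"
    and "finite_etale scale"
    and "\<eta> dvd 1"
    and "P = elt_order (modp \<eta> :: ('a, 'p) modp)"
    and "\<eta> ^ P = 1 + of_nat CARD('p) * U"
    and "\<omega> = modp U"
    and "E = adjoin modp_scale \<omega>"
    and "r = vector_space.dim modp_scale E"
    and "CARD('p) > r"
    and "y = \<gamma> * \<eta> ^ a"
    and "x = modp y"
    and "x \<notin> trace_perp modp_scale E"
    and "f = (\<lambda>t. alg_trace scale (y * binomial_power scale (\<eta> ^ P) t))"
  shows "(\<exists>F. restricted_expansion F f) \<and>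
    (\<forall>F. restricted_expansion F f \<longrightarrow>
      (\<exists>s W V. weierstrass_preparation F s W V) \<and>
      (\<forall>s W V. weierstrass_preparation F s W V \<longrightarrow>
        degree W \<le> r - 1 \<and>
        finite {z. f z = 0} \<and> (\<Sum>z | f z = 0. Polynomial.order z W) \<le> r - 1))"
proof -
  have alg: "is_algebra scale" using assms(2) by (simp add: finite_etale_def)
  obtain B where basis: "is_basis scale B" using assms(2) by (auto simp: finite_etale_def)
  obtain C where C: "is_basis (modp_scale :: 'p mod_ring \<Rightarrow> ('a, 'p) modp \<Rightarrow> _) C"
    using modp_is_basis_exists[OF alg basis] by blast
  obtain j where "j < r" and "alg_trace modp_scale (x * \<omega> ^ j) \<noteq> 0"
    using alg_trace_adjoin_nonzero[OF vector_space_modp_scale is_algebra_modp_scale C] assms(7,8,12)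
    by blast
  then have "alg_trace modp_scale (modp (y * U ^ j) :: ('a, 'p) modp) \<noteq> 0"
    by (simp add: assms(6,11) modp_mult modp_power)
  then have j: "\<not> residue_char dvd alg_trace scale (y * U ^ j)"
    by (simp add: alg_trace_modp[OF alg basis] reduce_eq_0_iff)
  have "CARD('p) \<ge> 3" using assms(1) by simp
  then obtain F0 where F0: "restricted_expansion F0 f" "\<not> residue_char ^ Suc j dvd fps_nth F0 j"
    "\<And>n. n \<ge> r \<Longrightarrow> residue_char ^ r dvd fps_nth F0 n"
    unfolding assms(13)
    using trace_binomial_power_expansion[OF _ alg basis assms(5,9) \<open>j < r\<close> j] by blast
  show ?thesis
  proof (intro conjI allI impI)
    show "\<exists>F. restricted_expansion F f" using F0(1) by blast
  next
    fix F assume "restricted_expansion F f"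
    \<comment> \<open>An arbitrary expansion of f is the constructed one, so the bounds on the
      coefficients of \<open>F0\<close> apply to it.\<close>
    then have F: "F = F0" using F0(1) by (rule restricted_expansion_unique)
    have "F0 \<noteq> 0" using F0(2) by auto
    then show "\<exists>s W V. weierstrass_preparation F s W V"
      using F0(1) unfolding F restricted_expansion_def by (intro weierstrass_preparation_exists) auto
    fix s W V assume prep: "weierstrass_preparation F s W V"
    have "s \<le> j"
    proof (rule ccontr)
      assume "\<not> s \<le> j"
      then have "residue_char ^ Suc j dvd (residue_char ^ s :: 'p padic_int)"
        by (intro le_imp_power_dvd) simp
      then show False
        using weierstrass_preparation_nth(1)[OF prep, of j] F0(2) F by (meson dvd_trans)
    qed
    show deg: "degree W \<le> r - 1"
    \<comment> \<open>As j < r, r is positive and the negated bound means degree W \<ge> r. There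
      the coefficient is divisible by p^r, hence by p^(s+1) because s \<le> j.\<close>
    proof (rule ccontr)
      assume "\<not> degree W \<le> r - 1"
      then have "residue_char ^ r dvd fps_nth F (degree W)" using F0(3) F by simp
      moreover have "residue_char ^ Suc s dvd (residue_char ^ r :: 'p padic_int)"
        using \<open>s \<le> j\<close> \<open>j < r\<close> by (intro le_imp_power_dvd) simp
      ultimately show False using weierstrass_preparation_nth(2)[OF prep] by (meson dvd_trans)
    qed
    have "W \<noteq> 0" using prep by (auto simp: weierstrass_preparation_def)
    have roots: "{z. f z = 0} \<subseteq> {z. poly W z = 0}"
    proof clarify
      fix z assume "f z = 0"
      then have "restricted F" "adic_sums residue_char (\<lambda>n. fps_nth F n * z ^ n) 0"
        using \<open>restricted_expansion F f\<close> unfolding restricted_expansion_def by metis+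
      then show "poly W z = 0" by (rule weierstrass_preparation_root[OF prep])
    qed
    moreover have fin: "finite {z. poly W z = 0}" using \<open>W \<noteq> 0\<close> by (rule poly_roots_finite)
    ultimately show "finite {z. f z = 0}" by (rule finite_subset)
    \<comment> \<open>Enlarging the index set to all p-adic integer roots of W only adds nonnegative
      orders, and these sum to at most the degree.\<close>
    have "(\<Sum>z | f z = 0. Polynomial.order z W) \<le> (\<Sum>z | poly W z = 0. Polynomial.order z W)"
      using fin roots by (rule sum_mono2) simp
    also have "\<dots> \<le> degree W" using \<open>W \<noteq> 0\<close> by (rule sum_order_le_degree)
    finally show "(\<Sum>z | f z = 0. Polynomial.order z W) \<le> r - 1" using deg by simp
  qed
qed

end
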